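(* Let $n\ge 3$ and let $T_{reg}^{\infty}=E_0E_1\dots E_n$ be a totally asymptotic regular simplex in $\overline{\mathbf{H}}^n$. Then the maximal generalized simplicial horoball density $\delta(\mathcal{B}_{opt}^n)$, i.e. the maximum of $\delta(\mathcal{B})$ over all admissible horoball arrangements $\mathcal{B}$ for $T_{reg}^{\infty}$, is given by $$\delta(\mathcal{B}^n_{opt})=\frac{1}{n-1}\,\frac{n}{2^{n-1}}\prod_{k=2}^{n-1}\Big(\frac{k-1}{k+1}\Big)^{\frac{n-k}{2}}\cdot\left(\Big(\sqrt{\tfrac{2n}{n-1}}\Big)^{n-1}+n\Big(\sqrt{\tfrac{2n}{n-1}}\Big)^{-(n-1)}\right)\frac{1}{\mathrm{Vol}(T_{reg}^{\infty})},$$ where $\mathrm{Vol}(T_{reg}^{\infty})$ denotes the volume of the ideal regular $n$-simplex.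
   Context: $\mathbf{H}^n$ is hyperbolic $n$-space of constant sectional curvature $-1$, and $\overline{\mathbf{H}}^n$ is $\mathbf{H}^n$ together with its boundary at infinity $\partial\mathbf{H}^n$. A totally asymptotic (ideal) simplex $T=E_0E_1\dots E_n$ is an $n$-simplex all of whose vertices $E_i$ lie on $\partial\mathbf{H}^n$; it is regular if its symmetry group acts transitively on the $k$-dimensional faces for every $0\le k\le n-1$. All its dihedral angles are then equal to $\arccos\frac{1}{n-1}$. An admissible horoball arrangement for $T$ is a family $\mathcal{B}=\{B_0,\dots,B_n\}$ of horoballs, with $B_i$ having ideal center $E_i$, such that (i) the horoballs form a packing, i.e. they do not overlap (their interiors are pairwise disjoint; tangency is allowed), and (ii) for each $i$, the horoball $B_i$ meets the hyperplane spanned by the vertices $E_j$, $j\neq i$, in at most one point (so it may touch this hyperplane). The horoballs at different vertices are not required to be of the same "type" (i.e. to occupy equal volumes in $T$). The generalized simplicial horoball density is $$\delta(\mathcal{B})=\frac{\sum_{i=0}^{n}\mathrm{vol}(B_i\cap T)}{\mathrm{vol}(T)}.$$ *)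

theory Defs
  imports "HOL-Analysis.Analysis"
begin

text \<open>
  Hyperbolic space of dimension n = CARD('n) and curvature -1 in the projective (Beltrami-Klein)
  model: the points are those of the open unit ball, the boundary at infinity is the unit sphere,
  and geodesics, hyperplanes and simplices are the traces of the Euclidean ones.
\<close>

abbreviation hyp_space :: "(real^'n) set" where
  "hyp_space \<equiv> ball 0 1"

abbreviation hyp_closure :: "(real^'n) set" where
  "hyp_closure \<equiv> cball 0 1"

abbreviation hyp_boundary :: "(real^'n) set" where
  "hyp_boundary \<equiv> sphere 0 1"

definition hdist :: "real^'n \<Rightarrow> real^'n \<Rightarrow> real" where
  "hdist x y = arcosh ((1 - x \<bullet> y) / sqrt ((1 - (norm x)\<^sup>2) * (1 - (norm y)\<^sup>2)))"

text \<open>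
  The Riemannian metric at x is
  |u|^2 / (1 - |x|^2) + (x \<bullet> u)^2 / (1 - |x|^2)^2, with determinant (1 - |x|^2)^(-(n+1)); hence the
  following volume density.
\<close>

definition hyp_measure :: "(real^'n) measure" where
  "hyp_measure = density lborel
     (\<lambda>x. ennreal (indicator hyp_space x * (1 - (norm x)\<^sup>2) powr (- (real CARD('n) + 1) / 2)))"

definition hyp_vol :: "(real^'n) set \<Rightarrow> real" where
  "hyp_vol S = measure hyp_measure S"

text \<open>
  Every isometry of hyperbolic space extends uniquely to a continuous map of its closure. The
  extension is part of the data here, so that isometries also act on ideal points.
\<close>

definition hyp_isometry :: "(real^'n \<Rightarrow> real^'n) \<Rightarrow> bool" where
  "hyp_isometry g \<longleftrightarrow>
     continuous_on hyp_closure g \<and> g ` hyp_space = hyp_space \<and>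
     (\<forall>x\<in>hyp_space. \<forall>y\<in>hyp_space. hdist (g x) (g y) = hdist x y)"

text \<open>
  The Busemann function of the ideal point e, normalised to vanish at the origin; the geodesic ray
  from the origin to e is t e for 0 \<le> t < 1. Horoballs are its (closed) sublevel sets.
\<close>

definition busemann :: "real^'n \<Rightarrow> real^'n \<Rightarrow> real" where
  "busemann e x = Lim (at_left 1) (\<lambda>t. hdist x (t *\<^sub>R e) - hdist 0 (t *\<^sub>R e))"

definition horoball_at :: "real^'n \<Rightarrow> (real^'n) set \<Rightarrow> bool" where
  "horoball_at e B \<longleftrightarrow> (\<exists>c. B = {x \<in> hyp_space. busemann e x \<le> c})"

text \<open>A simplex is given by its vertices E 0, ..., E n; other values of E are irrelevant.\<close>

definition ideal_simplex :: "(nat \<Rightarrow> real^'n) \<Rightarrow> bool" where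
  "ideal_simplex E \<longleftrightarrow>
     E ` {..CARD('n)} \<subseteq> hyp_boundary \<and> inj_on E {..CARD('n)} \<and>
     \<not> affine_dependent (E ` {..CARD('n)})"

definition simplex_of :: "(nat \<Rightarrow> real^'n) \<Rightarrow> (real^'n) set" where
  "simplex_of E = convex hull (E ` {..CARD('n)})"

definition symmetries :: "(real^'n) set \<Rightarrow> (real^'n \<Rightarrow> real^'n) set" where
  "symmetries T = {g. hyp_isometry g \<and> g ` T = T}"

definition regular_simplex :: "(nat \<Rightarrow> real^'n) \<Rightarrow> bool" where
  "regular_simplex E \<longleftrightarrow>
     (\<forall>k<CARD('n). \<forall>F F'.
        F face_of simplex_of E \<and> aff_dim F = int k \<and>
        F' face_of simplex_of E \<and> aff_dim F' = int k \<longrightarrow>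
        (\<exists>g\<in>symmetries (simplex_of E). g ` F = F'))"

definition opposite_hyperplane :: "(nat \<Rightarrow> real^'n) \<Rightarrow> nat \<Rightarrow> (real^'n) set" where
  "opposite_hyperplane E i = affine hull (E ` ({..CARD('n)} - {i})) \<inter> hyp_space"

definition admissible :: "(nat \<Rightarrow> real^'n) \<Rightarrow> (nat \<Rightarrow> (real^'n) set) \<Rightarrow> bool" where
  "admissible E B \<longleftrightarrow>
     (\<forall>i\<le>CARD('n). horoball_at (E i) (B i)) \<and>
     (\<forall>i\<le>CARD('n). \<forall>j\<le>CARD('n). i \<noteq> j \<longrightarrow> interior (B i) \<inter> interior (B j) = {}) \<and>
     (\<forall>i\<le>CARD('n). \<exists>\<^sub>\<le>\<^sub>1x. x \<in> B i \<inter> opposite_hyperplane E i)"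

definition horoball_density :: "(nat \<Rightarrow> real^'n) \<Rightarrow> (nat \<Rightarrow> (real^'n) set) \<Rightarrow> real" where
  "horoball_density E B =
     (\<Sum>i\<le>CARD('n). hyp_vol (B i \<inter> simplex_of E)) / hyp_vol (simplex_of E)"

end

theory Submission imports Defs begin

text \<open>
  Regularity enters only through the existence of weights \<open>w i\<close> that rescale the null vectors of
  the vertices to have equal Minkowski products (\<open>regular_ideal_simplex_weights\<close>): an edge function
  that is built from these products and is invariant under isometries must be constant because
  symmetries act transitively on edges.

  A horoball at \<open>E i\<close> is a sublevel set at some level \<open>k\<close> of the exponential of the Busemann
  function. In terms of the normalised scales \<open>s i = k * w i\<close> everything becomes explicit, for
  \<open>n\<close> the dimension and \<open>L = sqrt (2 * n / (n - 1))\<close>: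

  \<^item> two of the horoballs do not overlap if and only if \<open>s i * s j \<le> 1\<close>
    (\<open>disjoint_horoballs_iff\<close>);
  \<^item> a horoball meets the opposite hyperplane at most once if and only if \<open>s i \<le> L\<close>
    (\<open>meets_facet_at_most_once_iff\<close>);
  \<^item> the part of such a horoball in the simplex has volume \<open>K * s i ^ (n - 1)\<close> with the same \<open>K\<close>
    for all vertices (\<open>hyp_vol_horoball_simplex\<close>).

  With \<open>t i = s i ^ (n - 1)\<close>, the problem is to maximise the sum of \<open>n + 1\<close> positive numbers with
  \<open>t i * t j \<le> 1\<close> and \<open>t i \<le> T\<close>, where \<open>T = L ^ (n - 1)\<close>. At most one of them exceeds \<open>1\<close>, so
  the sum is at most \<open>t + n / t\<close> for some \<open>1 \<le> t \<le> T\<close>. This is convex in \<open>t\<close>, and because of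
  \<open>T \<ge> n\<close> (\<open>critical_scale_ge\<close>) the larger end
  value is \<open>T + n / T\<close>. It is attained when one horoball touches its opposite facet and the
  others touch that horoball.

  The volume computation works in Minkowski space, where the cone over the simplex is the image
  of an orthant under a linear map. The hyperbolic volume is an integral over this cone of a
  homogeneous density, truncated by a linear form. Integrating along the geodesics that end at the
  centre of the horoball reduces it to the Lebesgue volume of a Euclidean simplex, which is found
  from the determinant of its Gram matrix. The constant \<open>K\<close> contains the volume of the regular
  simplex with unit edges in dimension \<open>n - 1\<close>; \<open>simplex_product_formula\<close> identifies it with the
  product in the theorem.
\<close>

section \<open>Linear changes of variables and a determinant\<close>

lemma nn_integral_split_coordinate:
  fixes f :: "'a::euclidean_space \<Rightarrow> ennreal"
  assumes [measurable]: "f \<in> borel_measurable borel" and b: "b \<in> Basis"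
  shows "(\<integral>\<^sup>+x. f x \<partial>lborel) =
    (\<integral>\<^sup>+y. (\<integral>\<^sup>+s. f ((\<Sum>j\<in>Basis - {b}. y j *\<^sub>R j) + s *\<^sub>R b) \<partial>lborel) \<partial>(\<Pi>\<^sub>M j\<in>Basis - {b}. lborel))"
proof -
  interpret product_sigma_finite "\<lambda>_. lborel :: real measure" by standard
  have ins: "insert b (Basis - {b}) = Basis" using b by auto
  have "(\<integral>\<^sup>+x. f x \<partial>lborel) = (\<integral>\<^sup>+y. f (\<Sum>j\<in>Basis. y j *\<^sub>R j) \<partial>(\<Pi>\<^sub>M j\<in>Basis. lborel))"
    by (subst lborel_eq, subst nn_integral_distr) simp_all
  also have "\<dots> = (\<integral>\<^sup>+y. f (\<Sum>j\<in>insert b (Basis - {b}). y j *\<^sub>R j)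
      \<partial>(\<Pi>\<^sub>M j\<in>insert b (Basis - {b}). lborel))"
    by (simp only: ins)
  also have "\<dots> = (\<integral>\<^sup>+y. (\<integral>\<^sup>+s. f (\<Sum>j\<in>insert b (Basis - {b}). (y(b := s)) j *\<^sub>R j) \<partial>lborel)
      \<partial>(\<Pi>\<^sub>M j\<in>Basis - {b}. lborel))"
    by (rule product_nn_integral_insert) simp_all
  also have "\<dots> = (\<integral>\<^sup>+y. (\<integral>\<^sup>+s. f ((\<Sum>j\<in>Basis - {b}. y j *\<^sub>R j) + s *\<^sub>R b) \<partial>lborel)
      \<partial>(\<Pi>\<^sub>M j\<in>Basis - {b}. lborel))"
    by (subst sum.insert) (simp_all add: add.commute)
  finally show ?thesis .
qed

text \<open>
  Fubini in the direction of \<open>b\<close>: on each line parallel to \<open>b\<close> the shear is a translation,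
  because the amount \<open>x \<bullet> w\<close> does not change along the line.
\<close>

lemma nn_integral_shear:
  fixes f :: "'a::euclidean_space \<Rightarrow> ennreal"
  assumes f [measurable]: "f \<in> borel_measurable borel" and b: "b \<in> Basis"
    and w: "w \<bullet> b = 0"
  shows "(\<integral>\<^sup>+x. f (x + (x \<bullet> w) *\<^sub>R b) \<partial>lborel) = (\<integral>\<^sup>+x. f x \<partial>lborel)"
proof -
  let ?p = "\<lambda>y. \<Sum>j\<in>Basis - {b}. y j *\<^sub>R j"
  have "(\<integral>\<^sup>+s. f ((?p y + s *\<^sub>R b) + ((?p y + s *\<^sub>R b) \<bullet> w) *\<^sub>R b) \<partial>lborel) =
      (\<integral>\<^sup>+s. f (?p y + s *\<^sub>R b) \<partial>lborel)" for y :: "'a \<Rightarrow> real"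
  proof -
    have "(\<integral>\<^sup>+s. f (?p y + s *\<^sub>R b) \<partial>lborel) =
        ennreal \<bar>1\<bar> * (\<integral>\<^sup>+s. f (?p y + ((?p y \<bullet> w) + 1 * s) *\<^sub>R b) \<partial>lborel)"
      by (rule nn_integral_real_affine) simp_all
    moreover have eq: "?p y + ((?p y \<bullet> w) + 1 * s) *\<^sub>R b = (?p y + s *\<^sub>R b) + ((?p y + s *\<^sub>R b) \<bullet> w) *\<^sub>R b"
      for s using w by (simp add: inner_commute[of b] inner_add_left scaleR_add_left)
    ultimately show ?thesis by (simp only: eq abs_one ennreal_1 mult_1)
  qed
  then show ?thesis
    by (subst (1 2) nn_integral_split_coordinate[OF _ b]) simp_all
qed

text \<open>
  Both sides are multiplicative under composition, so it suffices to treat the elementary maps: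
  diagonal maps, transpositions of coordinates and elementary shears.
\<close>

lemma nn_integral_linear_change:
  fixes f :: "real^'n \<Rightarrow> real^'n" and h :: "real^'n \<Rightarrow> ennreal"
  assumes "linear f" and "det (matrix f) \<noteq> 0" and "h \<in> borel_measurable borel"
  shows "(\<integral>\<^sup>+x. h x \<partial>lborel) = ennreal \<bar>det (matrix f)\<bar> * (\<integral>\<^sup>+x. h (f x) \<partial>lborel)"
proof -
  have "det (matrix f) \<noteq> 0 \<longrightarrow> (\<forall>h \<in> borel_measurable borel.
      (\<integral>\<^sup>+x. h x \<partial>lborel) = ennreal \<bar>det (matrix f)\<bar> * (\<integral>\<^sup>+x. h (f x) \<partial>lborel))"
  proof (rule induct_linear_elementary [OF \<open>linear f\<close>])
    fix f g :: "real^'n \<Rightarrow> real^'n"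
    assume lin: "linear f" "linear g"
      and f: "det (matrix f) \<noteq> 0 \<longrightarrow> (\<forall>h \<in> borel_measurable borel.
        (\<integral>\<^sup>+x. h x \<partial>lborel) = ennreal \<bar>det (matrix f)\<bar> * (\<integral>\<^sup>+x. h (f x) \<partial>lborel))"
      and g: "det (matrix g) \<noteq> 0 \<longrightarrow> (\<forall>h \<in> borel_measurable borel.
        (\<integral>\<^sup>+x. h x \<partial>lborel) = ennreal \<bar>det (matrix g)\<bar> * (\<integral>\<^sup>+x. h (g x) \<partial>lborel))"
    have fm: "f \<in> borel_measurable borel"
      using lin(1) by (intro borel_measurable_continuous_onI linear_continuous_on) (simp add: linear_linear)
    show "det (matrix (f \<circ> g)) \<noteq> 0 \<longrightarrow> (\<forall>h \<in> borel_measurable borel.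
        (\<integral>\<^sup>+x. h x \<partial>lborel) = ennreal \<bar>det (matrix (f \<circ> g))\<bar> * (\<integral>\<^sup>+x. h ((f \<circ> g) x) \<partial>lborel))"
    proof (intro impI ballI)
      fix h :: "real^'n \<Rightarrow> ennreal"
      assume nz: "det (matrix (f \<circ> g)) \<noteq> 0" and h: "h \<in> borel_measurable borel"
      have det: "det (matrix (f \<circ> g)) = det (matrix f) * det (matrix g)"
        using matrix_compose[OF lin(2) lin(1)] by (simp add: det_mul)
      have "(\<integral>\<^sup>+x. h x \<partial>lborel) = ennreal \<bar>det (matrix f)\<bar> * (\<integral>\<^sup>+x. h (f x) \<partial>lborel)"
        using f nz h det by auto
      also have "(\<integral>\<^sup>+x. h (f x) \<partial>lborel) = ennreal \<bar>det (matrix g)\<bar> * (\<integral>\<^sup>+x. h (f (g x)) \<partial>lborel)"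
        using g nz det measurable_compose[OF fm h] by auto
      finally show "(\<integral>\<^sup>+x. h x \<partial>lborel) = ennreal \<bar>det (matrix (f \<circ> g))\<bar> * (\<integral>\<^sup>+x. h ((f \<circ> g) x) \<partial>lborel)"
        by (simp add: det abs_mult ennreal_mult mult.assoc)
    qed
  next
    fix f :: "real^'n \<Rightarrow> real^'n" and i
    assume "linear f" and "\<And>x. f x $ i = 0"
    then have "det (matrix f) = 0"
      by (intro det_zero_row[of i]) (auto simp: matrix_def row_def vec_eq_iff)
    then show "det (matrix f) \<noteq> 0 \<longrightarrow> (\<forall>h \<in> borel_measurable borel.
        (\<integral>\<^sup>+x. h x \<partial>lborel) = ennreal \<bar>det (matrix f)\<bar> * (\<integral>\<^sup>+x. h (f x) \<partial>lborel))" by simp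
  next
    fix c :: "'n \<Rightarrow> real"
    let ?f = "\<lambda>x::real^'n. \<chi> i. c i * x $ i"
    have det: "det (matrix ?f) = prod c UNIV"
      by (simp add: axis_def matrix_def det_diagonal)
    show "det (matrix ?f) \<noteq> 0 \<longrightarrow> (\<forall>h \<in> borel_measurable borel.
        (\<integral>\<^sup>+x. h x \<partial>lborel) = ennreal \<bar>det (matrix ?f)\<bar> * (\<integral>\<^sup>+x. h (?f x) \<partial>lborel))"
    proof (intro impI ballI)
      fix h :: "real^'n \<Rightarrow> ennreal"
      assume nz: "det (matrix ?f) \<noteq> 0" and [measurable]: "h \<in> borel_measurable borel"
      define d where "d = (\<lambda>b::real^'n. c (SOME i. b = axis i 1))"
      have d: "d (axis i 1) = c i" for i
        by (auto simp: d_def axis_eq_axis)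
      have B: "(Basis :: (real^'n) set) = (\<lambda>i. axis i 1) ` UNIV"
        by (auto simp: Basis_vec_def)
      have inj: "inj (\<lambda>i::'n. axis i (1::real))" by (auto simp: inj_on_def axis_eq_axis)
      have fx: "0 + (\<Sum>j\<in>Basis. (d j * (x \<bullet> j)) *\<^sub>R j) = ?f x" for x
      proof -
        have "(\<Sum>j\<in>Basis. (d j * (x \<bullet> j)) *\<^sub>R j) = (\<Sum>i\<in>UNIV. (c i * x $ i) *\<^sub>R axis i 1)"
          unfolding B sum.reindex[OF inj] by (simp add: d inner_axis)
        then show ?thesis by (simp add: vec_eq_iff axis_def if_distrib cong: if_cong)
      qed
      have pd: "(\<Prod>j\<in>(Basis::(real^'n) set). \<bar>d j\<bar>) = \<bar>prod c UNIV\<bar>"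
        by (simp add: B prod.reindex[OF inj] d abs_prod)
      have m[measurable]: "?f \<in> borel_measurable borel"
        by (rule borel_measurable_continuous_onI) (intro continuous_intros)
      have "(lborel::(real^'n) measure) = density (distr lborel borel ?f) (\<lambda>_. ennreal \<bar>prod c UNIV\<bar>)"
      proof -
        have "d j \<noteq> 0" if "j \<in> Basis" for j
          using that nz det by (auto simp: B d)
        from lborel_affine_euclidean[of d 0, OF this] show ?thesis
          unfolding fx pd .
      qed
      then have "(\<integral>\<^sup>+x. h x \<partial>lborel) =
          (\<integral>\<^sup>+x. h x \<partial>(density (distr lborel borel ?f) (\<lambda>_. ennreal \<bar>prod c UNIV\<bar>)))" by simp
      then show "(\<integral>\<^sup>+x. h x \<partial>lborel) = ennreal \<bar>det (matrix ?f)\<bar> * (\<integral>\<^sup>+x. h (?f x) \<partial>lborel)"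
        by (simp add: nn_integral_density nn_integral_distr nn_integral_cmult det)
    qed
  next
    fix m n :: 'n assume "m \<noteq> n"
    let ?f = "\<lambda>v::real^'n. \<chi> i. v $ Transposition.transpose m n i"
    have "matrix ?f $ i $ j = transpose (\<chi> i j. mat 1 $ i $ Transposition.transpose m n j) $ i $ j" for i j
      by (cases "Transposition.transpose m n i = j")
        (simp_all add: matrix_def mat_def axis_def Finite_Cartesian_Product.transpose_def)
    then have "matrix ?f = transpose (\<chi> i j. mat 1 $ i $ Transposition.transpose m n j)"
      by (simp only: vec_eq_iff simp_thms)
    then have det: "\<bar>det (matrix ?f)\<bar> = 1"
      by (simp add: det_permute_columns permutes_swap_id sign_swap_id abs_mult)
    have m[measurable]: "?f \<in> borel_measurable borel"
      by (rule borel_measurable_continuous_onI) (intro continuous_intros)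
    have "lborel = distr lborel borel ?f"
    proof (rule lborel_eqI)
      fix l u :: "real^'n" assume le: "\<And>b. b \<in> Basis \<Longrightarrow> l \<bullet> b \<le> u \<bullet> b"
      have eq: "?f -` box l u = box (?f l) (?f u)"
        by (auto simp: mem_box_cart) (metis transpose_involutory)+
      have B: "(Basis :: (real^'n) set) = (\<lambda>i. axis i 1) ` UNIV"
        by (auto simp: Basis_vec_def)
      have inj: "inj (\<lambda>i::'n. axis i (1::real))" by (auto simp: inj_on_def axis_eq_axis)
      have le': "l $ i \<le> u $ i" for i using le[of "axis i 1"] by (simp add: inner_axis)
      have "emeasure (distr lborel borel ?f) (box l u) = emeasure lborel (box (?f l) (?f u))"
        by (simp add: emeasure_distr eq)
      also have "\<dots> = ennreal (\<Prod>b\<in>Basis. (?f u - ?f l) \<bullet> b)"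
        by (rule emeasure_lborel_box) (auto simp: B inner_axis le')
      also have "(\<Prod>b\<in>Basis. (?f u - ?f l) \<bullet> b) = (\<Prod>i\<in>UNIV. (u - l) $ Transposition.transpose m n i)"
        by (simp add: B prod.reindex[OF inj] inner_axis)
      also have "\<dots> = (\<Prod>i\<in>UNIV. (u - l) $ i)"
        using prod.permute [OF permutes_swap_id, where S=UNIV and g="\<lambda>i. (u - l)$i", of m n] by (simp add: o_def)
      also have "\<dots> = (\<Prod>b\<in>Basis. (u - l) \<bullet> b)"
        by (simp add: B prod.reindex[OF inj] inner_axis)
      finally show "emeasure (distr lborel borel ?f) (box l u) = (\<Prod>b\<in>Basis. (u - l) \<bullet> b)" .
    qed simp
    then have "(\<integral>\<^sup>+x. h x \<partial>lborel) = (\<integral>\<^sup>+x. h (?f x) \<partial>lborel)"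
      if [measurable]: "h \<in> borel_measurable borel" for h :: "real^'n \<Rightarrow> ennreal"
      using nn_integral_distr[of ?f lborel borel h] by simp
    then show "det (matrix ?f) \<noteq> 0 \<longrightarrow> (\<forall>h \<in> borel_measurable borel.
        (\<integral>\<^sup>+x. h x \<partial>lborel) = ennreal \<bar>det (matrix ?f)\<bar> * (\<integral>\<^sup>+x. h (?f x) \<partial>lborel))"
      by (simp only: det ennreal_1 mult_1) blast
  next
    fix m n :: 'n assume mn: "m \<noteq> n"
    let ?f = "\<lambda>v::real^'n. \<chi> i. if i = m then v $ m + v $ n else v $ i"
    have fx: "?f x = x + (x \<bullet> axis n 1) *\<^sub>R axis m 1" for x
      using mn by (simp add: vec_eq_iff inner_axis) (simp add: axis_def)
    have "matrix ?f = (\<chi> k. if k = m then row m (mat 1) + 1 *s row n (mat 1) else row k (mat 1))"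
      using mn by (auto simp: matrix_def row_def mat_def axis_def vec_eq_iff)
    then have det: "det (matrix ?f) = 1"
      by (simp add: det_row_operation[OF mn] del: vector_smult_lid)
    show "det (matrix ?f) \<noteq> 0 \<longrightarrow> (\<forall>h \<in> borel_measurable borel.
        (\<integral>\<^sup>+x. h x \<partial>lborel) = ennreal \<bar>det (matrix ?f)\<bar> * (\<integral>\<^sup>+x. h (?f x) \<partial>lborel))"
    proof (intro impI ballI)
      fix h :: "real^'n \<Rightarrow> ennreal" assume h: "h \<in> borel_measurable borel"
      have "(\<integral>\<^sup>+x. h (x + (x \<bullet> axis n 1) *\<^sub>R axis m 1) \<partial>lborel) = (\<integral>\<^sup>+x. h x \<partial>lborel)"
        using mn by (intro nn_integral_shear h) (auto simp: inner_axis_axis)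
      then show "(\<integral>\<^sup>+x. h x \<partial>lborel) = ennreal \<bar>det (matrix ?f)\<bar> * (\<integral>\<^sup>+x. h (?f x) \<partial>lborel)"
        unfolding det by (simp only: fx abs_one ennreal_1 mult_1)
    qed
  qed
  with assms show ?thesis by blast
qed

text \<open>
  An orthogonal change of basis turns \<open>u\<close> into a multiple of a basis vector; then only one row of
  the identity is changed, and the off-diagonal part of that row is a combination of the others.
\<close>

lemma det_rank_one_update:
  fixes u v :: "real^'n"
  shows "det ((\<chi> i j. (if i = j then 1 else 0) + u $ i * v $ j) :: real^'n^'n) = 1 + u \<bullet> v"
proof -
  have axis_case: "det ((\<chi> i j. (if i = j then 1 else 0) + (c *\<^sub>R axis k 1) $ i * w $ j) :: real^'n^'n) = 1 + c * w $ k"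
    for c :: real and k :: 'n and w :: "real^'n"
  proof -
    define D :: "real^'n^'n" where "D = (\<chi> i j. if i = j then (if i = k then 1 + c * w $ k else 1) else 0)"
    have rowD: "row j D = axis j 1" if "j \<noteq> k" for j
      using that by (auto simp: D_def row_def axis_def vec_eq_iff)
    define x where "x = (\<Sum>j\<in>UNIV-{k}. (c * w $ j) *s axis j (1::real))"
    have "x \<in> vec.span {row j D |j. j \<noteq> k}" unfolding x_def
      by (intro vec.span_sum vec.span_scale vec.span_base) (auto simp: rowD[symmetric])
    then have "det (\<chi> i. if i = k then row k D + x else row i D) = det D"
      by (rule det_row_span)
    also have "det D = (\<Prod>i\<in>UNIV. D $ i $ i)"
      by (rule det_diagonal) (simp add: D_def)
    also have "\<dots> = 1 + c * w $ k"
      by (simp add: D_def)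
    also have "(\<chi> i. if i = k then row k D + x else row i D) =
        (\<chi> i j. (if i = j then 1 else 0) + (c *\<^sub>R axis k 1) $ i * w $ j)"
      by (auto simp: vec_eq_iff D_def x_def row_def axis_def if_distrib sum.If_cases cong: if_cong)
    finally show ?thesis .
  qed
  obtain k :: 'n where True by simp
  have norm_eq: "norm (norm u *\<^sub>R axis k (1::real)) = norm u" by simp
  obtain f :: "real^'n \<Rightarrow> real^'n" where f: "orthogonal_transformation f" "f (norm u *\<^sub>R axis k 1) = u"
    by (rule orthogonal_transformation_exists[OF norm_eq])
  define Q where "Q = matrix f"
  have lin: "linear f" using f(1) by (simp add: orthogonal_transformation_linear)
  have Q: "orthogonal_matrix Q" using f(1) by (simp add: Q_def orthogonal_transformation_matrix)
  have Qu: "Q *v (norm u *\<^sub>R axis k 1) = u" using f(2) lin by (simp add: Q_def matrix_works)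
  define w where "w = transpose Q *v v"
  define R :: "real^'n \<Rightarrow> real^'n \<Rightarrow> real^'n^'n" where "R = (\<lambda>a b. \<chi> i j. a $ i * b $ j)"
  have I: "(\<chi> i j. (if i = j then 1 else 0) + a $ i * b $ j) = mat 1 + R a b" for a b :: "real^'n"
    by (simp add: vec_eq_iff mat_def R_def)
  have RQ: "Q ** R a b = R (Q *v a) b" "R a b ** transpose Q = R a (Q *v b)" for a b
    by (simp_all add: vec_eq_iff R_def matrix_matrix_mult_def matrix_vector_mult_def transpose_def
        sum_distrib_left sum_distrib_right mult_ac)
  have QQ: "Q ** transpose Q = mat 1"
    using Q unfolding orthogonal_matrix_def by blast
  have Qw: "Q *v w = v"
    unfolding w_def matrix_vector_mul_assoc QQ by (simp only: matrix_vector_mul_lid)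
  have radd: "(A + B) ** C = A ** C + B ** C" for A B C :: "real^'n^'n"
    by (simp add: vec_eq_iff matrix_matrix_mult_def distrib_right sum.distrib)
  have "Q ** (mat 1 + R (norm u *\<^sub>R axis k 1) w) ** transpose Q = mat 1 + R u v"
    by (simp add: matrix_add_ldistrib radd RQ Qu Qw QQ)
  then have "det (mat 1 + R u v) = det Q * det (mat 1 + R (norm u *\<^sub>R axis k 1) w) * det (transpose Q)"
    by (metis det_mul)
  also have "\<dots> = det (mat 1 + R (norm u *\<^sub>R axis k 1) w)"
    using det_orthogonal_matrix[OF Q] by auto
  also have "\<dots> = 1 + norm u * w $ k"
    using axis_case[of "norm u" k w] unfolding I .
  also have "norm u * w $ k = (norm u *\<^sub>R axis k 1) \<bullet> w"
    by (simp add: inner_axis')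
  also have "\<dots> = u \<bullet> v"
    unfolding w_def by (metis Qu dot_lmul_matrix inner_commute transpose_matrix_vector)
  finally show ?thesis by (simp add: I)
qed

section \<open>Horoballs and equidistant ideal points\<close>

text \<open>
  In the hyperboloid model this is minus the Minkowski product of the point with the null vector
  \<open>(e, 1)\<close>; its logarithm is the Busemann function of \<open>e\<close>. All horoballs centred at \<open>e\<close> are
  its sublevel sets, and the level \<open>k\<close> is the size parameter used throughout.
\<close>

definition horofun :: "real^'n \<Rightarrow> real^'n \<Rightarrow> real" where
  "horofun e x = (1 - x \<bullet> e) / sqrt (1 - (norm x)\<^sup>2)"

definition horoball :: "real^'n \<Rightarrow> real \<Rightarrow> (real^'n) set" where
  "horoball e k = {x \<in> hyp_space. horofun e x \<le> k}"

lemma inner_less_one: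
  fixes x e :: "real^'n"
  assumes "norm x < 1" and "norm e \<le> 1"
  shows "x \<bullet> e < 1"
proof -
  have "x \<bullet> e \<le> norm x * norm e" by (rule norm_cauchy_schwarz)
  also have "\<dots> \<le> norm x * 1" by (intro mult_left_mono) (use assms in auto)
  finally show ?thesis using assms by simp
qed

lemma inner_less_one_sphere:
  fixes x e :: "real^'n"
  assumes "norm x = 1" and "norm e = 1" "x \<noteq> e"
  shows "x \<bullet> e < 1"
proof -
  have "(norm (x - e))\<^sup>2 = 2 * (1 - x \<bullet> e)"
    using assms by (simp add: power2_norm_eq_inner inner_diff_left inner_diff_right norm_eq_1 inner_commute)
  moreover have "(norm (x - e))\<^sup>2 > 0" using assms by simp
  ultimately show ?thesis by simp
qed

lemma norm_less_one_gap: "norm x < 1 \<Longrightarrow> 0 < 1 - (norm x)\<^sup>2"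
  by (simp add: abs_square_less_1)

lemma gap_pos_norm_less_one:
  fixes x :: "'a::real_normed_vector"
  assumes "0 < 1 - (norm x)\<^sup>2"
  shows "norm x < 1"
  using assms by (simp add: abs_square_less_1)

lemma horofun_le_iff:
  fixes x e :: "real^'n"
  assumes "norm e = 1" and "norm x < 1" and "0 < k"
  shows "horofun e x \<le> k \<longleftrightarrow> (1 - x \<bullet> e)\<^sup>2 \<le> k\<^sup>2 * (1 - (norm x)\<^sup>2)"
proof -
  have g: "0 < 1 - (norm x)\<^sup>2" using assms norm_less_one_gap by blast
  have a: "0 < 1 - x \<bullet> e" using inner_less_one assms by force
  have "horofun e x \<le> k \<longleftrightarrow> 1 - x \<bullet> e \<le> k * sqrt (1 - (norm x)\<^sup>2)"
    using g by (simp add: horofun_def field_simps)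
  also have "\<dots> \<longleftrightarrow> (1 - x \<bullet> e)\<^sup>2 \<le> (k * sqrt (1 - (norm x)\<^sup>2))\<^sup>2"
    using a g assms by (subst power2_le_iff_abs_le) auto
  also have "(k * sqrt (1 - (norm x)\<^sup>2))\<^sup>2 = k\<^sup>2 * (1 - (norm x)\<^sup>2)"
    using g by (simp add: power_mult_distrib)
  finally show ?thesis .
qed

lemma horofun_less_iff:
  fixes x e :: "real^'n"
  assumes "norm e = 1" and "norm x < 1" and "0 < k"
  shows "horofun e x < k \<longleftrightarrow> (1 - x \<bullet> e)\<^sup>2 < k\<^sup>2 * (1 - (norm x)\<^sup>2)"
proof -
  have g: "0 < 1 - (norm x)\<^sup>2" using assms norm_less_one_gap by blast
  have a: "0 < 1 - x \<bullet> e" using inner_less_one assms by force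
  have "horofun e x < k \<longleftrightarrow> 1 - x \<bullet> e < k * sqrt (1 - (norm x)\<^sup>2)"
    using g by (simp add: horofun_def field_simps)
  also have "\<dots> \<longleftrightarrow> \<bar>1 - x \<bullet> e\<bar> < \<bar>k * sqrt (1 - (norm x)\<^sup>2)\<bar>"
    using a g assms by simp
  also have "\<dots> \<longleftrightarrow> (1 - x \<bullet> e)\<^sup>2 < (k * sqrt (1 - (norm x)\<^sup>2))\<^sup>2"
    by (metis abs_le_square_iff not_less)
  also have "(k * sqrt (1 - (norm x)\<^sup>2))\<^sup>2 = k\<^sup>2 * (1 - (norm x)\<^sup>2)"
    using g by (simp add: power_mult_distrib)
  finally show ?thesis .
qed

lemma horofun_pos:
  assumes "norm e = 1" and "norm x < 1"
  shows "0 < horofun e x"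
  using inner_less_one[of x e] norm_less_one_gap[of x] assms by (simp add: horofun_def)

lemma continuous_on_horofun: "continuous_on hyp_space (horofun e)"
proof -
  have "sqrt (1 - (norm x)\<^sup>2) \<noteq> 0" if "x \<in> hyp_space" for x :: "real^'n"
    using that norm_less_one_gap[of x] by (metis less_irrefl mem_ball_0 real_sqrt_eq_zero_cancel_iff)
  then show ?thesis unfolding horofun_def by (intro continuous_intros) blast
qed

lemma sum_squared_le_card_sum_squares:
  fixes s :: "'n::finite \<Rightarrow> real"
  shows "(\<Sum>j\<in>UNIV. s j)\<^sup>2 \<le> real CARD('n) * (\<Sum>j\<in>UNIV. (s j)\<^sup>2)"
  using sum_squared_le_sum_of_squares[of s UNIV] by (simp add: mult.commute)

text \<open>
  The defect in the Cauchy-Schwarz inequality for \<open>s\<close> against the constant vector, written as a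
  sum of squares; it vanishes only for constant \<open>s\<close>.
\<close>

lemma sum_squares_deviation:
  fixes s :: "'n::finite \<Rightarrow> real"
  shows "(\<Sum>j\<in>UNIV. (real CARD('n) * s j - (\<Sum>k\<in>UNIV. s k))\<^sup>2)
    = real CARD('n) * (real CARD('n) * (\<Sum>j\<in>UNIV. (s j)\<^sup>2) - (\<Sum>j\<in>UNIV. s j)\<^sup>2)"
proof -
  define S where "S = (\<Sum>k\<in>UNIV. s k)"
  have "(\<Sum>j\<in>UNIV. (real CARD('n) * s j - S)\<^sup>2) =
    (\<Sum>j\<in>UNIV. (real CARD('n))\<^sup>2 * (s j)\<^sup>2 - 2 * real CARD('n) * S * s j + S\<^sup>2)"
    by (intro sum.cong) (auto simp: power2_diff power_mult_distrib algebra_simps)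
  also have "\<dots> = (real CARD('n))\<^sup>2 * (\<Sum>j\<in>UNIV. (s j)\<^sup>2) - 2 * real CARD('n) * S * S + real CARD('n) * S\<^sup>2"
    by (simp add: sum.distrib sum_subtractf sum_distrib_left[symmetric] S_def)
  finally show ?thesis by (simp add: S_def power2_eq_square algebra_simps)
qed

text \<open>
  Seen from an ideal point \<open>e\<close>, hyperbolic space is a half-space whose points at infinity other
  than \<open>e\<close> form a Euclidean space of one dimension less. The last assumption says that in this
  Euclidean space the other ideal vertices have pairwise distance \<open>d\<close>: projecting from \<open>e\<close>, the
  vertex \<open>v j\<close> becomes the vector \<open>y j\<close> below, which satisfies \<open>y j \<bullet> e = -1\<close>,
  and the assumption is equivalent to \<open>norm (y j - y k) = d\<close>. The regular ideal simplex
  has this property at each of its vertices, with a \<open>d\<close> that depends on the normalisation.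
\<close>

locale equilateral_horosphere =
  fixes e :: "real^'n" and v :: "'n \<Rightarrow> real^'n" and d :: real
  assumes norm_e: "norm e = 1" and norm_v: "\<And>j. norm (v j) = 1" and v_ne: "\<And>j. v j \<noteq> e"
    and d_pos: "0 < d"
    and equi: "\<And>j k. j \<noteq> k \<Longrightarrow> 1 - v j \<bullet> v k = d\<^sup>2 / 2 * (1 - v j \<bullet> e) * (1 - v k \<bullet> e)"
begin

definition beta :: "'n \<Rightarrow> real" where "beta j = 1 - v j \<bullet> e"

definition y :: "'n \<Rightarrow> real^'n" where "y j = (1 / beta j) *\<^sub>R (v j - e)"

definition vertex_matrix :: "real^'n^'n" where "vertex_matrix = (\<chi> i j. y j $ i)"

lemma beta_pos: "0 < beta j"
  using inner_less_one_sphere[OF norm_v norm_e v_ne] by (simp add: beta_def)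

lemma v_eq: "v j = e + beta j *\<^sub>R y j"
  using beta_pos[of j] by (simp add: y_def)

lemma ee: "e \<bullet> e = 1"
  using norm_e by (simp add: norm_eq_1)

lemma vv: "v j \<bullet> v j = 1"
  using norm_v by (simp add: norm_eq_1)

lemma y_inner_e: "y j \<bullet> e = - 1"
  using beta_pos[of j] by (simp add: y_def inner_diff_left ee) (simp add: beta_def field_simps)

lemma y_inner_y:
  "y j \<bullet> y k = 1 / beta j + 1 / beta k - (if j = k then 0 else d\<^sup>2 / 2)"
proof -
  have b: "beta j \<noteq> 0" "beta k \<noteq> 0" using beta_pos[of j] beta_pos[of k] by auto
  have ev: "e \<bullet> v i = v i \<bullet> e" for i by (rule inner_commute)
  have "y j \<bullet> y k = (v j \<bullet> v k - v j \<bullet> e - v k \<bullet> e + 1) / (beta j * beta k)"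
    using b by (simp add: y_def inner_diff_left inner_diff_right ee ev field_simps)
  also have "v j \<bullet> v k - v j \<bullet> e - v k \<bullet> e + 1 = beta j + beta k - (1 - v j \<bullet> v k)"
    by (simp add: beta_def)
  also have "1 - v j \<bullet> v k = (if j = k then 0 else d\<^sup>2 / 2) * (beta j * beta k)"
    using equi[of j k] by (auto simp: vv beta_def)
  finally show ?thesis using b by (simp add: field_simps)
qed

lemma vertex_matrix_mult: "vertex_matrix *v s = (\<Sum>j\<in>UNIV. s $ j *\<^sub>R y j)"
  by (simp add: vertex_matrix_def matrix_vector_mult_def vec_eq_iff mult.commute)

lemma comb_inner_e: "(vertex_matrix *v s) \<bullet> e = - (\<Sum>j\<in>UNIV. s $ j)"
  by (simp add: vertex_matrix_mult inner_sum_left y_inner_e sum_negf)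

text \<open>
  Polarisation: the mutual distances of the \<open>y j\<close> determine the norm of a combination up to
  the term that comes from the distances of the \<open>y j\<close> to the origin. Since the
  vector with space part \<open>t *\<^sub>R e + z\<close> and time part \<open>t\<close> has Minkowski square
  \<open>(norm z)\<^sup>2 + 2 * t * (z \<bullet> e)\<close>, this is what converts all later questions
  into inequalities between the sum of the \<open>s $ j\<close> and the sum of their squares.
\<close>

lemma comb_norm:
  "(norm (vertex_matrix *v s))\<^sup>2 = 2 * (\<Sum>j\<in>UNIV. s $ j) * (\<Sum>j\<in>UNIV. s $ j / beta j)
     - d\<^sup>2 / 2 * ((\<Sum>j\<in>UNIV. s $ j)\<^sup>2 - (\<Sum>j\<in>UNIV. (s $ j)\<^sup>2))"
proof -
  have "(norm (vertex_matrix *v s))\<^sup>2 = (\<Sum>j\<in>UNIV. \<Sum>k\<in>UNIV. s $ j * s $ k * (y j \<bullet> y k))"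
    unfolding power2_norm_eq_inner vertex_matrix_mult inner_sum_left inner_sum_right
    by (simp add: mult.assoc mult.left_commute inner_commute)
  also have "\<dots> = (\<Sum>j\<in>UNIV. \<Sum>k\<in>UNIV. (s $ j / beta j) * s $ k + s $ j * (s $ k / beta k)
      - d\<^sup>2 / 2 * (s $ j * s $ k) + (if j = k then d\<^sup>2 / 2 * (s $ j * s $ k) else 0))"
    by (intro sum.cong refl) (auto simp: y_inner_y algebra_simps)
  also have "\<dots> = (\<Sum>j\<in>UNIV. s $ j / beta j) * (\<Sum>k\<in>UNIV. s $ k)
      + (\<Sum>j\<in>UNIV. s $ j) * (\<Sum>k\<in>UNIV. s $ k / beta k)
      - d\<^sup>2 / 2 * ((\<Sum>j\<in>UNIV. s $ j) * (\<Sum>k\<in>UNIV. s $ k)) + d\<^sup>2 / 2 * (\<Sum>j\<in>UNIV. s $ j * s $ j)"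
    by (simp only: sum.distrib sum_subtractf sum_distrib_left[symmetric] sum_distrib_right[symmetric]
        sum.delta finite UNIV_I if_True sum.delta')
  finally show ?thesis by (simp add: power2_eq_square algebra_simps)
qed

text \<open>
  The vectors \<open>y j\<close> are the vertices of a regular simplex of edge length \<open>d\<close> in the hyperplane
  \<open>x \<bullet> e = -1\<close>. Moving the base of the cone over it inside this hyperplane is a shear and does
  not change the determinant, so the centre \<open>c\<close> may be moved to \<open>- e\<close>. After that the Gram
  matrix is a multiple of the identity plus a constant matrix.
\<close>

lemma det_vertex_matrix_square: "(det vertex_matrix)\<^sup>2 = real CARD('n) * (d\<^sup>2 / 2) ^ (CARD('n) - 1)"
proof -
  define n where "n = real CARD('n)"
  have n0: "n > 0" by (simp add: n_def)
  define a where "a = d\<^sup>2 / 2"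
  have a0: "a > 0" using d_pos by (simp add: a_def)
  define c where "c = (1 / n) *\<^sub>R (\<Sum>j\<in>UNIV. y j)"
  \<comment> \<open>The vertices relative to the centre; their Gram matrix depends on the mutual distances only.\<close>
  define q where "q j = y j - c" for j
  define r where "r = (1 - 1 / n) * a"
  have sum_q: "(\<Sum>j\<in>UNIV. q j) = 0"
  proof -
    have "(\<Sum>j\<in>UNIV. q j) = (\<Sum>j\<in>UNIV. y j) - n *\<^sub>R c"
      by (simp add: q_def sum_subtractf n_def scaleR_conv_of_real sum_constant_scaleR)
    then show ?thesis using n0 by (simp add: c_def)
  qed
  have ce: "c \<bullet> e = - 1"
    using n0 by (simp add: c_def inner_sum_left y_inner_e n_def)
  have qe: "q j \<bullet> e = 0" for j
    by (simp add: q_def inner_diff_left y_inner_e ce)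
  have dist: "q j \<bullet> q j + q k \<bullet> q k - 2 * (q j \<bullet> q k) = (if j = k then 0 else 2 * a)" for j k
  proof -
    have "q j \<bullet> q j + q k \<bullet> q k - 2 * (q j \<bullet> q k) = (q j - q k) \<bullet> (q j - q k)"
      by (simp add: inner_diff_left inner_diff_right inner_commute)
    also have "q j - q k = y j - y k" by (simp add: q_def)
    also have "(y j - y k) \<bullet> (y j - y k) = y j \<bullet> y j + y k \<bullet> y k - 2 * (y j \<bullet> y k)"
      by (simp add: inner_diff_left inner_diff_right inner_commute)
    finally show ?thesis by (simp add: y_inner_y a_def)
  qed
  have "(\<Sum>k\<in>UNIV. q j \<bullet> q j + q k \<bullet> q k - 2 * (q j \<bullet> q k)) = (n - 1) * (2 * a)" for j
    unfolding dist by (simp add: sum.If_cases n_def card_Diff_singleton Compl_eq_Diff_UNIV of_nat_diff)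
  then have row: "n * (q j \<bullet> q j) + (\<Sum>k\<in>UNIV. q k \<bullet> q k) = (n - 1) * (2 * a)" for j
    by (simp add: sum.distrib sum_subtractf sum_distrib_left[symmetric] inner_sum_right[symmetric] sum_q n_def)
  have "(\<Sum>j\<in>UNIV. n * (q j \<bullet> q j) + (\<Sum>k\<in>UNIV. q k \<bullet> q k)) = n * ((n - 1) * (2 * a))"
    unfolding row by (simp add: n_def)
  then have "2 * n * (\<Sum>k\<in>UNIV. q k \<bullet> q k) = n * ((n - 1) * (2 * a))"
    by (simp add: sum.distrib sum_distrib_left[symmetric] n_def)
  then have "(\<Sum>k\<in>UNIV. q k \<bullet> q k) = (n - 1) * a" using n0 by simp
  then have qq: "q j \<bullet> q j = r" for j
    using row[of j] n0 by (simp add: r_def field_simps)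
  have qk: "q j \<bullet> q k = (if j = k then a else 0) - a / n" for j k
  proof -
    have "q j \<bullet> q k = r - (if j = k then 0 else a)"
      using dist[of j k] qq[of j] qq[of k] by auto
    then show ?thesis using n0 by (simp add: r_def left_diff_distrib)
  qed
  \<comment> \<open>The simplex after the shear that moves its centre to \<open>- e\<close>.\<close>
  define z where "z j = q j - e" for j
  define Z :: "real^'n^'n" where "Z = (\<chi> i j. z j $ i)"
  have "transpose Z ** Z = (\<chi> i j. z i \<bullet> z j)"
    by (simp add: Z_def matrix_matrix_mult_def transpose_def inner_vec_def)
  also have "\<dots> = (\<chi> i j. (if i = j then a else 0) + (1 - a / n))"
  proof -
    have "e \<bullet> q j = 0" for j using qe[of j] by (simp add: inner_commute)
    then have "z i \<bullet> z j = (if i = j then a else 0) + (1 - a / n)" for i j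
      by (simp add: z_def inner_diff_left inner_diff_right qk ee qe)
    then show ?thesis by presburger
  qed
  also have "\<dots> = (\<chi> i j. if i = j then a else 0) **
      ((\<chi> i j. (if i = j then 1 else 0) + (\<chi> i. (1 - a / n) / a) $ i * (\<chi> i. 1) $ j) :: real^'n^'n)"
  proof -
    have "(\<Sum>k\<in>UNIV. (if i = k then a else 0) * ((if k = j then 1 else 0) + (1 - a / n) / a * 1)) =
        (\<Sum>k\<in>UNIV. if i = k then a * ((if k = j then 1 else 0) + (1 - a / n) / a) else 0)" for i j :: 'n
      by (intro sum.cong) auto
    also have "\<dots> i j = (if i = j then a else 0) + (1 - a / n)" for i j
      using a0 by (simp add: distrib_left)
    finally show ?thesis
      unfolding matrix_matrix_mult_def vec_lambda_beta by presburger
  qed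
  finally have "det (transpose Z ** Z) = det ((\<chi> i j. if i = j then a else 0) :: real^'n^'n) *
      (1 + (\<chi> i. (1 - a / n) / a) \<bullet> ((\<chi> i. 1) :: real^'n))"
    by (simp only: det_mul det_rank_one_update)
  also have "det ((\<chi> i j. if i = j then a else 0) :: real^'n^'n) = a ^ CARD('n)"
    by (subst det_diagonal) auto
  also have "a ^ CARD('n) = a * a ^ (CARD('n) - 1)"
    by (simp add: power_eq_if)
  also have "1 + (\<chi> i. (1 - a / n) / a) \<bullet> ((\<chi> i. 1) :: real^'n) = n / a"
    using a0 n0 by (simp add: inner_vec_def n_def[symmetric] field_simps)
  finally have detZ: "(det Z)\<^sup>2 = n * a ^ (CARD('n) - 1)"
    using a0 by (simp add: det_mul power2_eq_square)
  \<comment> \<open>Undo the shear: it is the identity plus a rank-one matrix, with \<open>w\<close> orthogonal to \<open>e\<close>.\<close>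
  define w where "w = c + e"
  have yz: "y j = z j + w" for j by (simp add: z_def q_def w_def)
  have ze: "z j \<bullet> e = - 1" for j by (simp add: z_def inner_diff_left qe ee)
  have "vertex_matrix = ((\<chi> i j. (if i = j then 1 else 0) + w $ i * (- e) $ j) :: real^'n^'n) ** Z"
  proof -
    have "(\<Sum>k\<in>UNIV. ((if i = k then 1 else 0) + w $ i * (- e) $ k) * z j $ k) = y j $ i" for i j
    proof -
      have "(\<Sum>k\<in>UNIV. ((if i = k then 1 else 0) + w $ i * (- e) $ k) * z j $ k) =
          (\<Sum>k\<in>UNIV. (if i = k then z j $ k else 0) - w $ i * (z j $ k * e $ k))"
        by (intro sum.cong) (auto simp: algebra_simps)
      also have "\<dots> = z j $ i - w $ i * (z j \<bullet> e)"
        by (simp add: sum_subtractf sum_distrib_left[symmetric] inner_vec_def)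
      finally show ?thesis by (simp add: ze yz)
    qed
    then show ?thesis
      by (simp only: vertex_matrix_def matrix_matrix_mult_def Z_def vec_eq_iff vec_lambda_beta simp_thms)
  qed
  then have "det vertex_matrix = (1 + w \<bullet> (- e)) * det Z"
    by (simp only: det_mul det_rank_one_update)
  also have "w \<bullet> (- e) = 0"
    by (simp add: w_def inner_add_left ce ee)
  finally show ?thesis using detZ by (simp add: n_def a_def)
qed

lemma inj_v: "inj v"
proof (rule injI, rule ccontr)
  fix j k assume eq: "v j = v k" and "j \<noteq> k"
  then have "0 = d\<^sup>2 / 2 * beta j * beta k"
    using equi[of j k] by (simp add: vv beta_def)
  then show False using d_pos beta_pos[of j] beta_pos[of k] by simp
qed

lemma mem_hull_iff:
  "x \<in> convex hull (insert e (range v)) \<longleftrightarrow>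
     (\<exists>c. (\<forall>j. 0 \<le> c j) \<and> sum c UNIV \<le> 1 \<and> x = e + (\<Sum>j\<in>UNIV. c j *\<^sub>R (v j - e)))"
    (is "?L \<longleftrightarrow> ?R")
proof
  have e_notin: "e \<notin> range v" using v_ne by auto
  {
    assume ?L
    then obtain u where u: "\<forall>x\<in>insert e (range v). 0 \<le> u x" "sum u (insert e (range v)) = 1"
        "(\<Sum>x\<in>insert e (range v). u x *\<^sub>R x) = x"
      by (subst (asm) convex_hull_finite) auto
    define c where "c j = u (v j)" for j
    have s: "u e + sum c UNIV = 1"
      using u(2) e_notin by (simp add: sum.reindex[OF inj_v] c_def o_def)
    have "x = u e *\<^sub>R e + (\<Sum>j\<in>UNIV. c j *\<^sub>R v j)"
      using u(3) e_notin by (simp add: sum.reindex[OF inj_v] c_def o_def)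
    also have "u e = 1 - sum c UNIV" using s by simp
    also have "(1 - sum c UNIV) *\<^sub>R e + (\<Sum>j\<in>UNIV. c j *\<^sub>R v j) = e + (\<Sum>j\<in>UNIV. c j *\<^sub>R (v j - e))"
      by (simp add: scaleR_diff_right sum_subtractf scaleR_sum_left algebra_simps)
    finally show ?R using u(1) s by (intro exI[of _ c]) (auto simp: c_def)
  }
  {
    assume ?R
    then obtain c where c: "\<And>j. 0 \<le> c j" "sum c UNIV \<le> 1" "x = e + (\<Sum>j\<in>UNIV. c j *\<^sub>R (v j - e))"
      by blast
    define u where "u x = (if x = e then 1 - sum c UNIV else c (inv v x))" for x
    have uv: "u (v j) = c j" for j using v_ne by (simp add: u_def inv_f_f[OF inj_v])
    have ue: "u e = 1 - sum c UNIV" by (simp add: u_def)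
    have "sum u (insert e (range v)) = 1"
      using e_notin by (simp add: sum.reindex[OF inj_v] o_def uv ue)
    moreover have "(\<Sum>x\<in>insert e (range v). u x *\<^sub>R x) = x"
      using e_notin by (simp add: sum.reindex[OF inj_v] o_def uv ue c(3) scaleR_diff_right
          sum_subtractf scaleR_sum_left algebra_simps)
    moreover have "\<forall>x\<in>insert e (range v). 0 \<le> u x"
      using c by (auto simp: uv ue)
    ultimately show ?L by (subst convex_hull_finite) auto
  }
qed

lemma mem_affine_hull_iff:
  "x \<in> affine hull (range v) \<longleftrightarrow>
     (\<exists>c. sum c UNIV = 1 \<and> x = e + (\<Sum>j\<in>UNIV. c j *\<^sub>R (v j - e)))"
    (is "?L \<longleftrightarrow> ?R")
proof
  have eq: "(\<Sum>j\<in>UNIV. c j *\<^sub>R v j) = e + (\<Sum>j\<in>UNIV. c j *\<^sub>R (v j - e))" if "sum c UNIV = 1" for c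
    using that by (simp add: scaleR_diff_right sum_subtractf scaleR_sum_left[symmetric])
  {
    assume ?L
    then obtain u where u: "sum u (range v) = 1" "(\<Sum>x\<in>range v. u x *\<^sub>R x) = x"
      unfolding affine_hull_finite[OF finite_imageI[OF finite]] by blast
    then have "sum (\<lambda>j. u (v j)) UNIV = 1" "x = (\<Sum>j\<in>UNIV. u (v j) *\<^sub>R v j)"
      by (simp_all add: sum.reindex[OF inj_v] o_def)
    then show ?R using eq by blast
  }
  {
    assume ?R
    then obtain c where c1: "sum c UNIV = 1" and cx: "x = e + (\<Sum>j\<in>UNIV. c j *\<^sub>R (v j - e))"
      by blast
    have c: "sum c UNIV = 1" "x = (\<Sum>j\<in>UNIV. c j *\<^sub>R v j)"
      unfolding eq[OF c1] by (fact c1, fact cx)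
    define u where "u x = c (inv v x)" for x
    have "sum u (range v) = 1" "(\<Sum>x\<in>range v. u x *\<^sub>R x) = x"
      using c by (simp_all add: u_def sum.reindex[OF inj_v] o_def inv_f_f[OF inj_v])
    then show ?L unfolding affine_hull_finite[OF finite_imageI[OF finite]] by blast
  }
qed

lemma cone_point_eq:
  "(\<Sum>j\<in>UNIV. c j *\<^sub>R (v j - e)) = vertex_matrix *v (\<chi> j. c j * beta j)"
  by (simp add: vertex_matrix_mult v_eq)

end

section \<open>The volume of a horoball in an ideal simplex\<close>

lemma nn_integral_scaleR:
  fixes f :: "'a::euclidean_space \<Rightarrow> ennreal"
  assumes [measurable]: "f \<in> borel_measurable borel" and c: "c > 0"
  shows "(\<integral>\<^sup>+x. f x \<partial>lborel) = ennreal (c ^ DIM('a)) * (\<integral>\<^sup>+x. f (c *\<^sub>R x) \<partial>lborel)"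
proof -
  have "(\<integral>\<^sup>+x. f x \<partial>lborel) =
      (\<integral>\<^sup>+x. f x \<partial>density (distr lborel borel (\<lambda>x. 0 + c *\<^sub>R x)) (\<lambda>_. ennreal (\<bar>c\<bar> ^ DIM('a))))"
    using lborel_affine[of c "0::'a"] c by simp
  also have "\<dots> = ennreal (c ^ DIM('a)) * (\<integral>\<^sup>+x. f (c *\<^sub>R x) \<partial>lborel)"
    using c by (simp add: nn_integral_density nn_integral_distr nn_integral_cmult)
  finally show ?thesis .
qed

lemma nn_integral_translate:
  fixes f :: "'a::euclidean_space \<Rightarrow> ennreal"
  assumes [measurable]: "f \<in> borel_measurable borel"
  shows "(\<integral>\<^sup>+x. f x \<partial>lborel) = (\<integral>\<^sup>+x. f (c + x) \<partial>lborel)"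
proof -
  have "(\<integral>\<^sup>+x. f x \<partial>lborel) = (\<integral>\<^sup>+x. f x \<partial>distr lborel borel ((+) c))"
    by (simp only: lborel_distr_plus)
  also have "\<dots> = (\<integral>\<^sup>+x. f (c + x) \<partial>lborel)"
    by (rule nn_integral_distr) simp_all
  finally show ?thesis .
qed

lemma nn_integral_power_Icc:
  assumes "a > 0" "n > 0"
  shows "(\<integral>\<^sup>+t. ennreal (t ^ (n - 1)) * indicator {0..a} t \<partial>lborel) = ennreal (a ^ n / real n)"
proof -
  have "(\<integral>\<^sup>+t. ennreal (t ^ (n - 1)) * indicator {0..a} t \<partial>lborel) =
      ennreal (a ^ n / real n - 0 ^ n / real n)"
  proof (rule nn_integral_FTC_Icc)
    show "((\<lambda>t. t ^ n / real n) has_real_derivative t ^ (n - 1)) (at t)" for t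
      using assms by (auto intro!: derivative_eq_intros)
  qed (use assms in auto)
  then show ?thesis using assms by (simp add: power_0_left)
qed

text \<open>
  A function on the cone over \<open>S\<close> in Minkowski space, with \<open>x\<close> the space and \<open>t\<close> the time
  coordinate, whose Lebesgue integral is the hyperbolic volume of \<open>S\<close> up to a factor. The power of
  \<open>t\<^sup>2 - (norm x)\<^sup>2\<close> gives the hyperbolic density; the rest makes the radial integral
  converge. Cutting off at \<open>t - x \<bullet> e \<le> 1\<close>, which is linear, and not at a level of the quadratic
  form is what makes the integral computable in the coordinates adapted to \<open>e\<close>: there the power
  of the linear form cancels, and the volume of a Euclidean simplex remains.
\<close>

definition cone_density :: "real^'n \<Rightarrow> (real^'n) set \<Rightarrow> real^'n \<Rightarrow> real \<Rightarrow> real" where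
  "cone_density e S x t =
     (if 0 < t \<and> (1 / t) *\<^sub>R x \<in> S \<and> t - x \<bullet> e \<le> 1
      then (t - x \<bullet> e) ^ CARD('n) * (t\<^sup>2 - (norm x)\<^sup>2) powr (- (real CARD('n) + 1) / 2) else 0)"

lemma cone_density_measurable:
  assumes [measurable]: "S \<in> sets borel"
  shows "(\<lambda>(x, t). ennreal (cone_density e S x t)) \<in> borel_measurable (borel \<Otimes>\<^sub>M borel)"
  unfolding cone_density_def by measurable

text \<open>
  Integrate first along the rays of the cone: substitute \<open>x = t *\<^sub>R x'\<close> and exchange the
  order of integration. The radial integral is that of \<open>t ^ (CARD('n) - 1)\<close> up to
  \<open>t = 1 / (1 - x' \<bullet> e)\<close>.
\<close>

lemma cone_integral:
  fixes S :: "(real^'n) set"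
  assumes S [measurable]: "S \<in> sets borel" and sub: "S \<subseteq> hyp_space" and e: "norm e = 1"
  shows "(\<integral>\<^sup>+t. (\<integral>\<^sup>+x. ennreal (cone_density e S x t) \<partial>lborel) \<partial>lborel) =
     emeasure hyp_measure S / of_nat CARD('n)"
proof -
  let ?n = "CARD('n)"
  define w where "w x = (1 - (norm x)\<^sup>2) powr (- (real ?n + 1) / 2)" for x :: "real^'n"
  have m1 [measurable]: "(\<lambda>(x, t). ennreal (cone_density e S x t)) \<in> borel_measurable (borel \<Otimes>\<^sub>M borel)"
    by (rule cone_density_measurable) fact
  have n0: "?n > 0" by simp
  have [measurable]: "w \<in> borel_measurable borel" unfolding w_def by measurable
  define F where "F x t = ennreal (w x * (1 - x \<bullet> e) ^ ?n) * indicator S x *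
      (ennreal (t ^ (?n - 1)) * indicator {0..1 / (1 - x \<bullet> e)} t)" for x t
  have mem: "{0..1 / (1 - x \<bullet> e)} = {t. 0 \<le> t \<and> t \<le> 1 / (1 - x \<bullet> e)}" for x by auto
  have mF: "(\<lambda>(x, t). F x t) \<in> borel_measurable (borel \<Otimes>\<^sub>M borel)"
    unfolding F_def mem indicator_def mem_Collect_eq by measurable
  have scale: "(\<integral>\<^sup>+x. ennreal (cone_density e S x t) \<partial>lborel) = (\<integral>\<^sup>+x. F x t \<partial>lborel)" if "t \<noteq> 0" for t
  proof (cases "t > 0")
    case False
    then have "cone_density e S x t = 0" "F x t = 0" for x
      using that by (auto simp: cone_density_def F_def)
    then show ?thesis by simp
  next
    case True
    have "(\<integral>\<^sup>+x. ennreal (cone_density e S x t) \<partial>lborel) =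
       ennreal (t ^ ?n) * (\<integral>\<^sup>+x. ennreal (cone_density e S (t *\<^sub>R x) t) \<partial>lborel)"
      using nn_integral_scaleR[of "\<lambda>x. ennreal (cone_density e S x t)" t] True by simp
    also have "\<dots> = (\<integral>\<^sup>+x. ennreal (t ^ ?n) * ennreal (cone_density e S (t *\<^sub>R x) t) \<partial>lborel)"
      by (rule nn_integral_cmult[symmetric]) measurable
    also have "\<dots> = (\<integral>\<^sup>+x. F x t \<partial>lborel)"
    proof (rule nn_integral_cong)
      fix x :: "real^'n"
      show "ennreal (t ^ ?n) * ennreal (cone_density e S (t *\<^sub>R x) t) = F x t"
      proof (cases "x \<in> S")
        case False
        then show ?thesis using True by (simp add: cone_density_def F_def)
      next
        case xS: True
        then have nx: "norm x < 1" using sub by auto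
        have a: "0 < 1 - x \<bullet> e" using inner_less_one[of x e] nx e by simp
        have g: "0 < 1 - (norm x)\<^sup>2" using norm_less_one_gap nx by blast
        have 1: "t - (t *\<^sub>R x) \<bullet> e = t * (1 - x \<bullet> e)" by (simp add: algebra_simps)
        have 2: "t\<^sup>2 - (norm (t *\<^sub>R x))\<^sup>2 = t\<^sup>2 * (1 - (norm x)\<^sup>2)"
          by (simp add: power_mult_distrib algebra_simps)
        have 3: "(t\<^sup>2 * (1 - (norm x)\<^sup>2)) powr (- (real ?n + 1) / 2) = t powr (- (real ?n + 1)) * w x"
        proof -
          have "t\<^sup>2 powr (- (real ?n + 1) / 2) = t powr (- (real ?n + 1))"
          proof -
            have "t\<^sup>2 = t powr 2" using True by simp
            moreover have "2 * (- (real ?n + 1) / 2) = - (real ?n + 1)" by simp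
            ultimately show ?thesis by (simp only: powr_powr)
          qed
          then show ?thesis using g True by (simp add: powr_mult w_def)
        qed
        have 4: "t powr (- (real ?n + 1)) = 1 / t ^ (?n + 1)"
        proof -
          have "t powr (- (real ?n + 1)) = 1 / t powr (real (?n + 1))"
            by (subst powr_minus_divide) (simp add: add.commute)
          also have "t powr (real (?n + 1)) = t ^ (?n + 1)"
            using True by (rule powr_realpow)
          finally show ?thesis .
        qed
        have tn: "t ^ ?n = t * t ^ (?n - 1)" using n0 by (simp add: power_eq_if)
        have 5: "t * (1 - x \<bullet> e) \<le> 1 \<longleftrightarrow> t \<in> {0..1 / (1 - x \<bullet> e)}"
          using a True by (simp add: field_simps)
        have wx: "w x \<ge> 0" by (simp add: w_def)
        have 6: "t ^ ?n * ((t * (1 - x \<bullet> e)) ^ ?n * (1 / t ^ (?n + 1) * w x)) =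
            w x * (1 - x \<bullet> e) ^ ?n * t ^ (?n - 1)"
        proof -
          have "t ^ ?n * (1 / t ^ (?n + 1)) = 1 / t" using True by simp
          then have "t ^ ?n * ((t * (1 - x \<bullet> e)) ^ ?n * (1 / t ^ (?n + 1) * w x)) =
              (1 / t) * t ^ ?n * (w x * (1 - x \<bullet> e) ^ ?n)"
            by (simp add: power_mult_distrib)
          also have "(1 / t) * t ^ ?n = t ^ (?n - 1)" unfolding tn using True by simp
          finally show ?thesis by (simp add: mult.commute)
        qed
        show ?thesis
        proof (cases "t \<in> {0..1 / (1 - x \<bullet> e)}")
          case True
          have "ennreal (t ^ ?n) * ennreal (cone_density e S (t *\<^sub>R x) t) =
             ennreal (t ^ ?n * ((t * (1 - x \<bullet> e)) ^ ?n * (1 / t ^ (?n + 1) * w x)))"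
            using True \<open>t > 0\<close> xS a wx unfolding cone_density_def 1 2 3 4 5
            by (subst ennreal_mult[symmetric]) auto
          also have "\<dots> = F x t"
            unfolding 6 F_def using True xS \<open>t > 0\<close> wx a by (simp add: ennreal_mult)
          finally show ?thesis .
        next
          case False
          then show ?thesis unfolding cone_density_def 1 5 F_def by auto
        qed
      qed
    qed
    finally show ?thesis .
  qed
  have "(\<integral>\<^sup>+t. (\<integral>\<^sup>+x. ennreal (cone_density e S x t) \<partial>lborel) \<partial>lborel) =
      (\<integral>\<^sup>+t. (\<integral>\<^sup>+x. F x t \<partial>lborel) \<partial>lborel)"
    using AE_lborel_singleton[of "0::real"] by (intro nn_integral_cong_AE) (auto simp: scale)
  also have "\<dots> = (\<integral>\<^sup>+x. (\<integral>\<^sup>+t. F x t \<partial>lborel) \<partial>lborel)"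
    by (rule lborel_pair.Fubini') (use mF in simp)
  also have "\<dots> = (\<integral>\<^sup>+x. ennreal (w x) * indicator S x / of_nat ?n \<partial>lborel)"
  proof (rule nn_integral_cong)
    fix x :: "real^'n"
    show "(\<integral>\<^sup>+t. F x t \<partial>lborel) = ennreal (w x) * indicator S x / of_nat ?n"
    proof (cases "x \<in> S")
      case False
      then show ?thesis by (simp add: F_def)
    next
      case True
      then have nx: "norm x < 1" using sub by auto
      have a: "0 < 1 - x \<bullet> e" using inner_less_one[of x e] nx e by simp
      have wx: "w x \<ge> 0" by (simp add: w_def)
      have "(\<integral>\<^sup>+t. F x t \<partial>lborel) = ennreal (w x * (1 - x \<bullet> e) ^ ?n) *
          (\<integral>\<^sup>+t. ennreal (t ^ (?n - 1)) * indicator {0..1 / (1 - x \<bullet> e)} t \<partial>lborel)"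
        unfolding F_def using True by (simp add: nn_integral_cmult)
      also have "\<dots> = ennreal (w x * (1 - x \<bullet> e) ^ ?n) * ennreal ((1 / (1 - x \<bullet> e)) ^ ?n / real ?n)"
        using a n0 by (subst nn_integral_power_Icc) auto
      also have "\<dots> = ennreal (w x / real ?n)"
        using a wx by (subst ennreal_mult[symmetric]) (auto simp: power_divide)
      also have "\<dots> = ennreal (w x) * indicator S x / of_nat ?n"
        using True wx n0 by (simp add: divide_ennreal[symmetric] ennreal_of_nat_eq_real_of_nat)
      finally show ?thesis .
    qed
  qed
  also have "\<dots> = (\<integral>\<^sup>+x. ennreal (w x) * indicator S x \<partial>lborel) / of_nat ?n"
    by (rule nn_integral_divide) measurable
  also have "(\<integral>\<^sup>+x. ennreal (w x) * indicator S x \<partial>lborel) = emeasure hyp_measure S"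
  proof -
    have "emeasure hyp_measure S =
       (\<integral>\<^sup>+x. ennreal (indicator hyp_space x * (1 - (norm x)\<^sup>2) powr (- (real ?n + 1) / 2)) * indicator S x \<partial>lborel)"
    proof -
      have [measurable]: "hyp_space \<in> sets (borel :: (real^'n) measure)" by simp
      show ?thesis unfolding hyp_measure_def by (rule emeasure_density) (use S in measurable)
    qed
    also have "\<dots> = (\<integral>\<^sup>+x. ennreal (w x) * indicator S x \<partial>lborel)"
      using sub by (intro nn_integral_cong) (auto simp: w_def indicator_def)
    finally show ?thesis ..
  qed
  finally show ?thesis .
qed

lemma nn_integral_power_tail:
  fixes a b c m :: real
  assumes "a > 0" "c > 0" "m > 1"
  shows "(\<integral>\<^sup>+t. ennreal ((a * t - b) powr (- m)) * indicator {(c + b) / a..} t \<partial>lborel) =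
     ennreal (c powr (1 - m) / (a * (m - 1)))"
proof -
  let ?F = "\<lambda>t. - ((a * t - b) powr (1 - m)) / (a * (m - 1))"
  have "(\<integral>\<^sup>+t. ennreal ((a * t - b) powr (- m)) * indicator {(c + b) / a..} t \<partial>lborel) =
      ennreal (0 - ?F ((c + b) / a))"
  proof (rule nn_integral_FTC_atLeast)
    fix t assume t: "(c + b) / a \<le> t"
    then have "a * t - b \<ge> c" using assms by (simp add: field_simps)
    then have p: "a * t - b > 0" using assms by simp
    have "((\<lambda>t. (a * t - b) powr (1 - m)) has_real_derivative (1 - m) * (a * t - b) powr (1 - m - 1) * a) (at t)"
      using p by (auto intro!: derivative_eq_intros)
    from DERIV_cdivide[OF DERIV_minus[OF this], of "a * (m - 1)"]
    have "(?F has_real_derivative - ((1 - m) * (a * t - b) powr (1 - m - 1) * a) / (a * (m - 1))) (at t)" .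
    moreover have "- ((1 - m) * (a * t - b) powr (1 - m - 1) * a) = (a * t - b) powr (- m) * (a * (m - 1))"
      by (simp add: algebra_simps)
    moreover have "a * (m - 1) \<noteq> 0" using assms by simp
    then have "(a * t - b) powr (- m) * (a * (m - 1)) / (a * (m - 1)) = (a * t - b) powr (- m)"
      by (rule nonzero_mult_div_cancel_right)
    ultimately show "(?F has_real_derivative (a * t - b) powr (- m)) (at t)"
      by (simp only:)
    show "0 \<le> (a * t - b) powr (- m)" by simp
  next
    have "filterlim (\<lambda>t. a * t - b) at_top at_top"
      using filterlim_tendsto_add_at_top[OF tendsto_const[of "-b"]
        filterlim_tendsto_pos_mult_at_top[OF tendsto_const[of a] assms(1) filterlim_ident]] by simp
    then have "((\<lambda>t. (a * t - b) powr (1 - m)) \<longlongrightarrow> 0) at_top"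
      using assms by (intro tendsto_neg_powr) auto
    from tendsto_divide[OF tendsto_minus[OF this] tendsto_const[of "a * (m - 1)"]]
    show "(?F \<longlongrightarrow> 0) at_top" using assms by simp
  qed measurable
  also have "a * ((c + b) / a) - b = c" using assms by simp
  finally show ?thesis by simp
qed

context equilateral_horosphere
begin

text \<open>
  The simplex with vertices \<open>0\<close> and \<open>y j\<close>, that is, the cone over the \<open>y j\<close> cut off at
  \<open>- (z \<bullet> e) \<le> 1\<close>.
\<close>

definition cross_section :: "(real^'n) set" where
  "cross_section = (\<lambda>s. vertex_matrix *v s) ` (convex hull (insert 0 Basis))"

lemma det_vertex_matrix_nonzero: "det vertex_matrix \<noteq> 0"
  using det_vertex_matrix_square d_pos by auto

lemma norm_translate: "(norm (t *\<^sub>R e + z))\<^sup>2 = t\<^sup>2 + 2 * t * (z \<bullet> e) + (norm z)\<^sup>2"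
proof -
  have "(norm (t *\<^sub>R e + z))\<^sup>2 = (t *\<^sub>R e + z) \<bullet> (t *\<^sub>R e + z)"
    by (rule power2_norm_eq_inner)
  also have "\<dots> = t * t + 2 * t * (z \<bullet> e) + z \<bullet> z"
    by (simp add: inner_add_left inner_add_right ee inner_commute[of e z] algebra_simps)
  finally show ?thesis by (simp add: dot_square_norm power2_eq_square)
qed

text \<open>
  In the coordinates \<open>(z, t)\<close> with \<open>x = t *\<^sub>R e + z\<close>, lines in direction \<open>t\<close> are the
  geodesics ending at \<open>e\<close>. Membership in the horoball is a lower bound on \<open>t\<close>. The two
  conditions for the simplex are that \<open>z\<close> lies in the cone over the \<open>y j\<close> and another lower
  bound on \<open>t\<close>, for the facet opposite to \<open>e\<close>. The hypothesis on \<open>k * d\<close> says that the horoball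
  does not cross this facet, so that the second bound follows from the first.
\<close>

lemma mem_horoball_simplex_iff:
  assumes k: "0 < k" and kd: "(k * d)\<^sup>2 * (real CARD('n) - 1) \<le> 2 * real CARD('n)"
    and a: "0 < - (z \<bullet> e)"
  shows "(0 < t \<and> (1 / t) *\<^sub>R (t *\<^sub>R e + z) \<in> horoball e k \<inter> convex hull (insert e (range v))) \<longleftrightarrow>
     (\<exists>s. (\<forall>j. 0 \<le> s $ j) \<and> z = vertex_matrix *v s) \<and> ((z \<bullet> e)\<^sup>2 / k\<^sup>2 + (norm z)\<^sup>2) / (2 * (- (z \<bullet> e))) \<le> t"
    (is "?L \<longleftrightarrow> ?R")
proof -
  define al where "al = - (z \<bullet> e)"
  have al: "0 < al" using a by (simp add: al_def)
  have ze: "z \<bullet> e = - al" by (simp add: al_def)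
  define x where "x = (1 / t) *\<^sub>R (t *\<^sub>R e + z)"
  have xe: "1 - x \<bullet> e = al / t" if "t \<noteq> 0"
  proof -
    have "x \<bullet> e = (t - al) / t" by (simp add: x_def inner_add_left ee ze)
    also have "\<dots> = 1 - al / t" using that by (simp add: diff_divide_distrib)
    finally show ?thesis by simp
  qed
  have nx: "1 - (norm x)\<^sup>2 = (2 * t * al - (norm z)\<^sup>2) / t\<^sup>2" if "t \<noteq> 0"
  proof -
    have "(norm x)\<^sup>2 = (1 / t)\<^sup>2 * (norm (t *\<^sub>R e + z))\<^sup>2"
      by (simp add: x_def power_divide)
    also have "(norm (t *\<^sub>R e + z))\<^sup>2 = t\<^sup>2 - 2 * t * al + (norm z)\<^sup>2"
      by (simp add: norm_translate ze)
    finally show ?thesis using that by (simp add: field_simps power2_eq_square)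
  qed
  have lower: "(al\<^sup>2 / k\<^sup>2 + (norm z)\<^sup>2) / (2 * al) \<le> t \<longleftrightarrow> al\<^sup>2 \<le> k\<^sup>2 * (2 * t * al - (norm z)\<^sup>2)"
    using al k by (simp add: field_simps)
  have horo: "x \<in> horoball e k \<longleftrightarrow> al\<^sup>2 \<le> k\<^sup>2 * (2 * t * al - (norm z)\<^sup>2)" if t: "0 < t"
  proof -
    have eq: "(1 - x \<bullet> e)\<^sup>2 \<le> k\<^sup>2 * (1 - (norm x)\<^sup>2) \<longleftrightarrow> al\<^sup>2 \<le> k\<^sup>2 * (2 * t * al - (norm z)\<^sup>2)"
      using t by (simp add: xe nx power_divide divide_right_mono field_simps)
    show ?thesis
    proof
      assume "x \<in> horoball e k"
      then show "al\<^sup>2 \<le> k\<^sup>2 * (2 * t * al - (norm z)\<^sup>2)"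
        using horofun_le_iff[OF norm_e _ k, of x] eq by (auto simp: horoball_def)
    next
      assume L: "al\<^sup>2 \<le> k\<^sup>2 * (2 * t * al - (norm z)\<^sup>2)"
      have "0 < al\<^sup>2" using al by simp
      then have "0 < 2 * t * al - (norm z)\<^sup>2" using L k by (smt (verit) mult_nonneg_nonpos zero_le_power2)
      then have "0 < 1 - (norm x)\<^sup>2" using nx t by simp
      then have "norm x < 1" by (simp add: abs_square_less_1)
      then show "x \<in> horoball e k"
        using horofun_le_iff[OF norm_e _ k, of x] eq L by (auto simp: horoball_def)
    qed
  qed
  have hull: "x \<in> convex hull (insert e (range v)) \<Longrightarrow> \<exists>s. (\<forall>j. 0 \<le> s $ j) \<and> z = vertex_matrix *v s" if t: "0 < t"
  proof -
    assume "x \<in> convex hull (insert e (range v))"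
    then obtain c where c: "\<And>j. 0 \<le> c j" "x = e + (\<Sum>j\<in>UNIV. c j *\<^sub>R (v j - e))"
      using mem_hull_iff by blast
    define s :: "real^'n" where "s = (\<chi> j. t * (c j * beta j))"
    have "vertex_matrix *v s = t *\<^sub>R (\<Sum>j\<in>UNIV. c j *\<^sub>R (v j - e))"
      by (simp add: cone_point_eq vertex_matrix_mult s_def scaleR_sum_right)
    also have "\<dots> = t *\<^sub>R (x - e)" by (simp add: c(2))
    also have "\<dots> = z" using t by (simp add: x_def algebra_simps)
    finally have "z = vertex_matrix *v s" ..
    moreover have "0 \<le> s $ j" for j
      using t c(1)[of j] beta_pos[of j] by (simp add: s_def)
    ultimately show ?thesis by blast
  qed
  have hull': "0 < t \<and> x \<in> convex hull (insert e (range v))"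
    if s: "\<forall>j. 0 \<le> s $ j" "z = vertex_matrix *v s" and L: "al\<^sup>2 \<le> k\<^sup>2 * (2 * t * al - (norm z)\<^sup>2)" for s
  proof -
    let ?S = "\<Sum>j\<in>UNIV. s $ j" and ?Q = "\<Sum>j\<in>UNIV. (s $ j)\<^sup>2" and ?l = "\<Sum>j\<in>UNIV. s $ j / beta j"
    let ?n = "real CARD('n)"
    have Sal: "?S = al" using comb_inner_e[of s] s(2) ze by simp
    have "(k * d)\<^sup>2 / 2 * (al\<^sup>2 - ?Q) \<le> al\<^sup>2"
    proof -
      have Q: "al\<^sup>2 \<le> ?n * ?Q"
        using sum_squared_le_card_sum_squares[of "($) s"] Sal by simp
      have "(k * d)\<^sup>2 * (?n * (al\<^sup>2 - ?Q)) \<le> (k * d)\<^sup>2 * ((?n - 1) * al\<^sup>2)"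
        using Q by (intro mult_left_mono) (auto simp: algebra_simps)
      also have "\<dots> = (k * d)\<^sup>2 * (?n - 1) * al\<^sup>2" by simp
      also have "\<dots> \<le> 2 * ?n * al\<^sup>2" by (intro mult_right_mono kd) simp
      finally have "?n * ((k * d)\<^sup>2 / 2 * (al\<^sup>2 - ?Q)) \<le> ?n * al\<^sup>2" by (simp add: field_simps)
      then show ?thesis by simp
    qed
    moreover have "k\<^sup>2 * (2 * al * ?l - (norm z)\<^sup>2) = (k * d)\<^sup>2 / 2 * (al\<^sup>2 - ?Q)"
    proof -
      have "2 * al * ?l - (norm z)\<^sup>2 = d\<^sup>2 / 2 * (al\<^sup>2 - ?Q)"
        using comb_norm[of s] unfolding s(2)[symmetric] Sal by simp
      then show ?thesis by (simp add: power_mult_distrib)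
    qed
    ultimately have "k\<^sup>2 * (2 * al * ?l - (norm z)\<^sup>2) \<le> k\<^sup>2 * (2 * t * al - (norm z)\<^sup>2)"
      using L by linarith
    then have lt: "?l \<le> t" using k al by simp
    have term_nonneg: "0 \<le> s $ j / beta j" for j using s(1) beta_pos[of j] by simp
    have "0 < ?l"
    proof -
      have "\<exists>j. s $ j \<noteq> 0" using Sal al by (metis less_irrefl sum.neutral)
      then obtain j where "0 < s $ j" using s(1) by (metis less_eq_real_def)
      then have "0 < s $ j / beta j" using beta_pos[of j] by simp
      then show ?thesis using term_nonneg by (intro sum_pos2[of _ j]) auto
    qed
    then have t: "0 < t" using lt by simp
    define c where "c j = s $ j / (beta j * t)" for j
    have sum_c: "(\<Sum>j\<in>UNIV. c j) = ?l / t" by (simp add: c_def sum_divide_distrib divide_divide_eq_left)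
    have cpos: "0 \<le> c j" for j using term_nonneg[of j] t beta_pos[of j] s(1) by (simp add: c_def)
    have "x = e + (\<Sum>j\<in>UNIV. c j *\<^sub>R (v j - e))"
    proof -
      have "(\<Sum>j\<in>UNIV. c j *\<^sub>R (v j - e)) = (\<Sum>j\<in>UNIV. (1 / t) *\<^sub>R (s $ j *\<^sub>R y j))"
        using beta_pos by (intro sum.cong) (auto simp: v_eq c_def less_imp_neq[THEN not_sym] divide_simps)
      also have "\<dots> = (1 / t) *\<^sub>R z" by (simp add: s(2) vertex_matrix_mult scaleR_sum_right)
      finally show ?thesis using t by (simp add: x_def scaleR_add_right)
    qed
    then have "x \<in> convex hull (insert e (range v))"
      unfolding mem_hull_iff using cpos lt t by (intro exI[of _ c]) (simp add: sum_c)
    then show ?thesis using t by simp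
  qed
  have "?L \<longleftrightarrow> 0 < t \<and> x \<in> horoball e k \<and> x \<in> convex hull (insert e (range v))"
    by (simp add: x_def)
  also have "\<dots> \<longleftrightarrow> (\<exists>s. (\<forall>j. 0 \<le> s $ j) \<and> z = vertex_matrix *v s) \<and> al\<^sup>2 \<le> k\<^sup>2 * (2 * t * al - (norm z)\<^sup>2)"
    using horo hull hull' by blast
  finally show ?thesis by (simp add: ze lower)
qed

lemma cross_section_iff:
  "z \<in> cross_section - {0} \<longleftrightarrow>
     (\<exists>s. (\<forall>j. 0 \<le> s $ j) \<and> z = vertex_matrix *v s) \<and> 0 < - (z \<bullet> e) \<and> - (z \<bullet> e) \<le> 1"
proof -
  have std: "s \<in> convex hull (insert 0 Basis) \<longleftrightarrow> (\<forall>j. 0 \<le> s $ j) \<and> (\<Sum>j\<in>UNIV. s $ j) \<le> 1" for s :: "real^'n"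
  proof -
    have B: "(Basis :: (real^'n) set) = (\<lambda>i. axis i 1) ` UNIV"
      by (auto simp: Basis_vec_def)
    have inj: "inj (\<lambda>i::'n. axis i (1::real))" by (auto simp: inj_on_def axis_eq_axis)
    have "(\<Sum>i\<in>Basis. s \<bullet> i) = (\<Sum>j\<in>UNIV. s $ j)"
      unfolding B by (simp add: sum.reindex[OF inj] inner_axis)
    moreover have "(\<forall>i\<in>Basis. 0 \<le> s \<bullet> i) \<longleftrightarrow> (\<forall>j. 0 \<le> s $ j)"
      unfolding B by (simp add: inner_axis)
    ultimately show ?thesis unfolding std_simplex by simp
  qed
  have pos: "0 < (\<Sum>j\<in>UNIV. s $ j) \<longleftrightarrow> vertex_matrix *v s \<noteq> 0" if "\<forall>j. 0 \<le> s $ j" for s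
  proof
    assume "0 < (\<Sum>j\<in>UNIV. s $ j)"
    then show "vertex_matrix *v s \<noteq> 0" using comb_inner_e[of s] by auto
  next
    assume "vertex_matrix *v s \<noteq> 0"
    then have "s \<noteq> 0" by auto
    then obtain j where "s $ j \<noteq> 0" by (auto simp: vec_eq_iff)
    then have "0 < s $ j" using that by (metis less_eq_real_def)
    then show "0 < (\<Sum>j\<in>UNIV. s $ j)" using that by (intro sum_pos2[of _ j]) auto
  qed
  show ?thesis
    unfolding cross_section_def using std pos comb_inner_e by fastforce
qed

lemma compact_cross_section: "compact cross_section"
  unfolding cross_section_def
  by (intro compact_continuous_image finite_imp_compact_convex_hull matrix_vector_mult_linear_continuous_on) simp

lemma cross_section_measure:
  "emeasure lborel (cross_section - {0}) = ennreal (\<bar>det vertex_matrix\<bar> / fact CARD('n))"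
proof -
  let ?std = "convex hull (insert 0 Basis) :: (real^'n) set"
  have lin: "linear ((*v) vertex_matrix)" by (rule matrix_vector_mul_linear)
  have inj: "inj ((*v) vertex_matrix)"
    using det_vertex_matrix_nonzero by (simp add: det_nz_iff_inj[OF lin, symmetric])
  have cs: "cross_section \<in> sets borel"
    by (intro borel_closed compact_imp_closed compact_cross_section)
  have "emeasure lborel (cross_section - {0}) = emeasure lborel cross_section"
    by (rule emeasure_Diff_null_set) (use cs in \<open>auto intro: null_setsI\<close>)
  also have "\<dots> = (\<integral>\<^sup>+x. indicator cross_section x \<partial>lborel)"
    using cs by simp
  also have "\<dots> = ennreal \<bar>det (matrix ((*v) vertex_matrix))\<bar> * (\<integral>\<^sup>+x. indicator cross_section (vertex_matrix *v x) \<partial>lborel)"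
    by (rule nn_integral_linear_change[OF lin]) (use det_vertex_matrix_nonzero cs in auto)
  also have "(\<integral>\<^sup>+x. indicator cross_section (vertex_matrix *v x) \<partial>lborel) = (\<integral>\<^sup>+x. indicator ?std x \<partial>lborel)"
    using inj by (intro nn_integral_cong) (auto simp: cross_section_def indicator_def inj_def)
  also have "\<dots> = emeasure lborel ?std"
    by (intro nn_integral_indicator) (auto intro!: borel_closed compact_imp_closed finite_imp_compact_convex_hull)
  also have "\<dots> = ennreal (1 / fact CARD('n))"
    using emeasure_std_simplex[where 'a="real^'n"] by simp
  finally show ?thesis
    by (simp add: ennreal_mult[symmetric])
qed

lemma horoball_measurable [measurable]: "horoball a k \<in> sets borel"
proof -
  have "{x \<in> space borel. norm x < 1 \<and> horofun a x \<le> k} \<in> sets borel"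
    unfolding horofun_def by measurable
  then show ?thesis by (simp add: horoball_def)
qed

text \<open>
  On each geodesic ending at \<open>e\<close> the integral runs over a half-line and is elementary. The
  integral of the power of the quadratic form is inversely proportional to
  \<open>(- (z \<bullet> e)) ^ CARD('n)\<close>, which is the other factor in \<open>cone_density\<close>; the product
  does not depend on \<open>z\<close>.
\<close>

lemma vertical_integral:
  assumes n: "CARD('n) \<ge> 2"
    and k: "0 < k" and kd: "(k * d)\<^sup>2 * (real CARD('n) - 1) \<le> 2 * real CARD('n)"
  shows "(\<integral>\<^sup>+t. ennreal (cone_density e (horoball e k \<inter> convex hull (insert e (range v))) (t *\<^sub>R e + z) t) \<partial>lborel)
     = ennreal (k ^ (CARD('n) - 1) / (real CARD('n) - 1)) * indicator (cross_section - {0}) z"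
proof -
  let ?n = "CARD('n)"
  let ?S = "horoball e k \<inter> convex hull (insert e (range v))"
  define al where "al = - (z \<bullet> e)"
  define m where "m = (real ?n + 1) / 2"
  define b where "b = (norm z)\<^sup>2"
  define c where "c = al\<^sup>2 / k\<^sup>2"
  have 1: "t - (t *\<^sub>R e + z) \<bullet> e = al" for t
    by (simp add: inner_add_left ee al_def)
  have 2: "t\<^sup>2 - (norm (t *\<^sub>R e + z))\<^sup>2 = 2 * al * t - b" for t
    by (simp add: norm_translate b_def al_def)
  have 3: "- (real ?n + 1) / 2 = - m" unfolding m_def by (rule minus_divide_left[symmetric])
  show ?thesis
  proof (cases "0 < al")
    case False
    have "cone_density e ?S (t *\<^sub>R e + z) t = 0" for t
    proof (rule ccontr)
      assume "cone_density e ?S (t *\<^sub>R e + z) t \<noteq> 0"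
      then have t: "0 < t" "(1 / t) *\<^sub>R (t *\<^sub>R e + z) \<in> ?S"
        by (auto simp: cone_density_def split: if_splits)
      then have "((1 / t) *\<^sub>R (t *\<^sub>R e + z)) \<bullet> e < 1"
        by (intro inner_less_one) (auto simp: horoball_def norm_e)
      then have "t - al < t" using t by (simp add: inner_add_left ee al_def field_simps)
      then show False using False by simp
    qed
    moreover have "z \<notin> cross_section - {0}"
      using False cross_section_iff by (auto simp: al_def)
    ultimately show ?thesis by simp
  next
    case al: True
    define C where "C = (\<exists>s. (\<forall>j. 0 \<le> s $ j) \<and> z = vertex_matrix *v s)"
    have "cone_density e ?S (t *\<^sub>R e + z) t =
        (if C \<and> al \<le> 1 then al ^ ?n * (2 * al * t - b) powr (- m) * indicator {(c + b) / (2 * al)..} t else 0)" for t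
      using mem_horoball_simplex_iff[OF k kd, of z t] al
      unfolding cone_density_def 1 2 3 C_def[symmetric]
      by (auto simp: al_def[symmetric] c_def b_def al_def[THEN arg_cong[of _ _ uminus], simplified, symmetric] indicator_def)
    then have "(\<integral>\<^sup>+t. ennreal (cone_density e ?S (t *\<^sub>R e + z) t) \<partial>lborel) =
       (\<integral>\<^sup>+t. (if C \<and> al \<le> 1 then ennreal (al ^ ?n) else 0) *
          (ennreal ((2 * al * t - b) powr (- m)) * indicator {(c + b) / (2 * al)..} t) \<partial>lborel)"
      using al by (intro nn_integral_cong) (auto simp: ennreal_mult indicator_def)
    also have "\<dots> = (if C \<and> al \<le> 1 then ennreal (al ^ ?n) else 0) *
        ennreal (c powr (1 - m) / (2 * al * (m - 1)))"
      using al k n by (subst nn_integral_cmult) (simp_all add: nn_integral_power_tail c_def m_def)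
    also have "\<dots> = ennreal (al ^ ?n * (c powr (1 - m) / (2 * al * (m - 1)))) * indicator (cross_section - {0}) z"
    proof -
      have "indicator (cross_section - {0}) z = (if C \<and> al \<le> 1 then 1 else 0 :: ennreal)"
        using al cross_section_iff[of z] by (simp add: indicator_def C_def al_def)
      moreover have nonneg: "0 \<le> c powr (1 - m) / (2 * al * (m - 1))"
        using al n by (simp add: m_def)
      moreover from nonneg have "ennreal (al ^ ?n * (c powr (1 - m) / (2 * al * (m - 1)))) =
          ennreal (al ^ ?n) * ennreal (c powr (1 - m) / (2 * al * (m - 1)))"
        using al by (intro ennreal_mult) simp_all
      ultimately show ?thesis
        by (cases "C \<and> al \<le> 1") (simp_all only: simp_thms if_True if_False mult_1_right mult_zero_left mult_zero_right)
    qed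
    also have "al ^ ?n * (c powr (1 - m) / (2 * al * (m - 1))) = k ^ (?n - 1) / (real ?n - 1)"
    proof -
      have "c powr (1 - m) = (al / k) powr (2 * (1 - m))"
      proof -
        have "c = (al / k) powr 2" using al k by (simp add: c_def power_divide)
        then show ?thesis by (simp only: powr_powr)
      qed
      also have "2 * (1 - m) = - real (?n - 1)" using n by (simp add: m_def field_simps of_nat_diff)
      also have "(al / k) powr (- real (?n - 1)) = (k / al) ^ (?n - 1)"
      proof -
        have "(al / k) powr (- real p) = (k / al) ^ p" for p
        proof -
          have "(al / k) powr (- real p) = inverse ((al / k) ^ p)"
            using al k by (simp add: powr_minus powr_realpow)
          then show ?thesis by (simp add: power_divide)
        qed
        then show ?thesis .
      qed
      finally have "c powr (1 - m) = (k / al) ^ (?n - 1)" .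
      moreover have "al ^ ?n = al * al ^ (?n - 1)" by (simp add: power_eq_if)
      moreover have "2 * al * (m - 1) = al * (real ?n - 1)" by (simp add: m_def field_simps)
      ultimately show ?thesis using al by (simp add: power_divide)
    qed
    finally show ?thesis .
  qed
qed

text \<open>
  Compute the integral of \<open>cone_density\<close> twice: along the rays of the cone, which gives the
  hyperbolic volume, and along the geodesics ending at \<open>e\<close>, which gives the Euclidean volume of
  \<open>cross_section\<close>.
\<close>

lemma hyp_vol_horoball_simplex:
  assumes n: "CARD('n) \<ge> 2"
    and k: "0 < k" and kd: "(k * d)\<^sup>2 * (real CARD('n) - 1) \<le> 2 * real CARD('n)"
  shows "hyp_vol (horoball e k \<inter> convex hull (insert e (range v))) =
     (k * d) ^ (CARD('n) - 1) * sqrt (real CARD('n)) /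
       ((real CARD('n) - 1) * fact (CARD('n) - 1) * sqrt 2 ^ (CARD('n) - 1))"
proof -
  let ?n = "CARD('n)"
  let ?S = "horoball e k \<inter> convex hull (insert e (range v))"
  define K where "K = k ^ (?n - 1) / (real ?n - 1)"
  define D where "D = \<bar>det vertex_matrix\<bar> / fact ?n"
  have K0: "K \<ge> 0" using k n by (simp add: K_def)
  have D0: "D \<ge> 0" by (simp add: D_def)
  have n0: "real ?n > 0" by simp
  have S [measurable]: "?S \<in> sets borel"
    by (intro sets.Int horoball_measurable borel_closed compact_imp_closed finite_imp_compact_convex_hull) simp
  have cs: "cross_section \<in> sets borel"
    by (intro borel_closed compact_imp_closed compact_cross_section)
  have m1 [measurable]: "(\<lambda>(x, t). ennreal (cone_density e ?S x t)) \<in> borel_measurable (borel \<Otimes>\<^sub>M borel)"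
    by (rule cone_density_measurable) fact
  have m2: "(\<lambda>(t, z). ennreal (cone_density e ?S (t *\<^sub>R e + z) t)) \<in> borel_measurable (borel \<Otimes>\<^sub>M borel)"
    by measurable
  have "emeasure hyp_measure ?S / of_nat ?n =
      (\<integral>\<^sup>+t. (\<integral>\<^sup>+x. ennreal (cone_density e ?S x t) \<partial>lborel) \<partial>lborel)"
    using norm_e by (intro cone_integral[symmetric] S) (auto simp: horoball_def)
  also have "\<dots> = (\<integral>\<^sup>+t. (\<integral>\<^sup>+z. ennreal (cone_density e ?S (t *\<^sub>R e + z) t) \<partial>lborel) \<partial>lborel)"
    by (intro nn_integral_cong nn_integral_translate) measurable
  also have "\<dots> = (\<integral>\<^sup>+z. (\<integral>\<^sup>+t. ennreal (cone_density e ?S (t *\<^sub>R e + z) t) \<partial>lborel) \<partial>lborel)"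
    by (rule lborel_pair.Fubini') (use m2 in simp)
  also have "\<dots> = (\<integral>\<^sup>+z. ennreal K * indicator (cross_section - {0}) z \<partial>lborel)"
    by (simp only: vertical_integral[OF n k kd] K_def)
  also have "\<dots> = ennreal K * ennreal D"
    using cs by (subst nn_integral_cmult_indicator) (auto simp: cross_section_measure D_def)
  also have "\<dots> = ennreal (K * D)" using K0 D0 by (simp add: ennreal_mult)
  finally have q: "emeasure hyp_measure ?S / of_nat ?n = ennreal (K * D)" .
  have "emeasure hyp_measure ?S = of_nat ?n * (emeasure hyp_measure ?S / of_nat ?n)"
  proof -
    have "of_nat ?n * (emeasure hyp_measure ?S / of_nat ?n) = of_nat ?n * emeasure hyp_measure ?S / of_nat ?n"
      by (rule ennreal_times_divide)
    also have "\<dots> = emeasure hyp_measure ?S"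
      unfolding mult.commute[of "of_nat ?n"] by (rule mult_divide_eq_ennreal) simp_all
    finally show ?thesis ..
  qed
  also have "\<dots> = ennreal (real ?n * (K * D))"
    unfolding q using K0 D0 by (simp add: ennreal_of_nat_eq_real_of_nat ennreal_mult)
  finally have "hyp_vol ?S = real ?n * (K * D)"
    using K0 D0 by (simp add: hyp_vol_def measure_def)
  also have "\<bar>det vertex_matrix\<bar> = sqrt (real ?n) * (d / sqrt 2) ^ (?n - 1)"
  proof -
    have "\<bar>det vertex_matrix\<bar> = sqrt ((det vertex_matrix)\<^sup>2)" by simp
    also have "\<dots> = sqrt (real ?n) * sqrt (d\<^sup>2 / 2) ^ (?n - 1)"
      unfolding det_vertex_matrix_square by (simp add: real_sqrt_mult real_sqrt_power)
    also have "sqrt (d\<^sup>2 / 2) = d / sqrt 2" using d_pos by (simp add: real_sqrt_divide)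
    finally show ?thesis .
  qed
  then have "real ?n * (K * D) = real ?n * (K * (sqrt (real ?n) * (d / sqrt 2) ^ (?n - 1) / fact ?n))"
    by (simp add: D_def)
  also have "(fact ?n :: real) = real ?n * fact (?n - 1)"
    by (rule fact_reduce) simp
  also have "real ?n * (K * (sqrt (real ?n) * (d / sqrt 2) ^ (?n - 1) / (real ?n * fact (?n - 1)))) =
     (k * d) ^ (?n - 1) * sqrt (real ?n) / ((real ?n - 1) * fact (?n - 1) * sqrt 2 ^ (?n - 1))"
    using n0 by (simp add: K_def power_divide power_mult_distrib ac_simps)
  finally show ?thesis .
qed

end

section \<open>Isometries and the normalisation of regular ideal simplices\<close>

lemma minkowski_cauchy_schwarz:
  fixes x y :: "real^'n"
  assumes "norm x < 1" "norm y < 1"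
  shows "(1 - (norm x)\<^sup>2) * (1 - (norm y)\<^sup>2) \<le> (1 - x \<bullet> y)\<^sup>2"
proof -
  have "2 * (x \<bullet> y) \<le> (norm x)\<^sup>2 + (norm y)\<^sup>2"
  proof -
    have "0 \<le> (norm (x - y))\<^sup>2" by simp
    also have "(norm (x - y))\<^sup>2 = (norm x)\<^sup>2 + (norm y)\<^sup>2 - 2 * (x \<bullet> y)"
      by (simp add: power2_norm_eq_inner inner_diff_left inner_diff_right inner_commute)
    finally show ?thesis by simp
  qed
  define X where "X = (norm x)\<^sup>2"
  define Y where "Y = (norm y)\<^sup>2"
  define q where "q = x \<bullet> y"
  have "X < 1" unfolding X_def using assms norm_less_one_gap[of x] by simp
  have D: "0 \<le> X + Y - 2 * q"
    using \<open>2 * (x \<bullet> y) \<le> (norm x)\<^sup>2 + (norm y)\<^sup>2\<close> by (simp add: X_def Y_def q_def)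
  have "X * Y - q\<^sup>2 \<le> X * (X + Y - 2 * q)"
    using zero_le_power2[of "X - q"] by (simp add: power2_eq_square algebra_simps)
  also have "\<dots> \<le> 1 * (X + Y - 2 * q)"
    using \<open>X < 1\<close> D by (intro mult_right_mono) auto
  finally have "(1 - X) * (1 - Y) \<le> (1 - q)\<^sup>2"
    by (simp add: power2_eq_square algebra_simps)
  then show ?thesis by (simp add: X_def Y_def q_def)
qed

definition cosh_dist :: "real^'n \<Rightarrow> real^'n \<Rightarrow> real" where
  "cosh_dist x y = (1 - x \<bullet> y) / sqrt ((1 - (norm x)\<^sup>2) * (1 - (norm y)\<^sup>2))"

lemma cosh_dist_ge_1:
  assumes "norm x < 1" "norm y < 1"
  shows "1 \<le> cosh_dist x y"
proof -
  have p: "0 < (1 - (norm x)\<^sup>2) * (1 - (norm y)\<^sup>2)"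
    using assms norm_less_one_gap by (metis mult_pos_pos)
  have "0 < 1 - x \<bullet> y" using inner_less_one[of x y] assms by simp
  then have "sqrt ((1 - (norm x)\<^sup>2) * (1 - (norm y)\<^sup>2)) \<le> 1 - x \<bullet> y"
    using minkowski_cauchy_schwarz[OF assms] by (intro real_le_lsqrt) auto
  then show ?thesis using p by (simp add: cosh_dist_def)
qed

lemma hdist_eq: "hdist x y = arcosh (cosh_dist x y)"
  by (simp add: hdist_def cosh_dist_def)

text \<open>
  Writing \<open>arcosh\<close> as a logarithm, the factors \<open>sqrt (1 - t\<^sup>2)\<close>, which make both distances
  diverge, cancel in the difference, and what remains is continuous up to \<open>t = 1\<close>.
\<close>

lemma busemann_eq_ln_horofun:
  fixes e x :: "real^'n"
  assumes e: "norm e = 1" and x: "norm x < 1"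
  shows "busemann e x = ln (horofun e x)"
proof -
  define N where "N = 1 - (norm x)\<^sup>2"
  have N: "0 < N" using x norm_less_one_gap by (simp add: N_def)
  define a where "a t = (1 - t * (x \<bullet> e)) / sqrt N" for t
  define g where "g t = ln ((a t + sqrt ((a t)\<^sup>2 - (1 - t\<^sup>2))) / (1 + t))" for t
  have g_eq: "hdist x (t *\<^sub>R e) - hdist 0 (t *\<^sub>R e) = g t" if t: "0 < t" "t < 1" for t
  proof -
    have nt: "norm (t *\<^sub>R e) = t" using t e by simp
    have T: "0 < 1 - t\<^sup>2" using t by (simp add: abs_square_less_1)
    have c1: "cosh_dist x (t *\<^sub>R e) = a t / sqrt (1 - t\<^sup>2)"
      using N T by (simp add: cosh_dist_def a_def e N_def[symmetric] real_sqrt_mult)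
    have c0: "cosh_dist 0 (t *\<^sub>R e) = 1 / sqrt (1 - t\<^sup>2)"
      by (simp add: cosh_dist_def e)
    have ge: "1 \<le> cosh_dist x (t *\<^sub>R e)" "1 \<le> cosh_dist 0 (t *\<^sub>R e)"
      using t x nt by (auto intro!: cosh_dist_ge_1)
    have at: "a t > 0" using ge(1) T unfolding c1 by (smt (verit) divide_nonpos_pos real_sqrt_gt_zero)
    have s1: "sqrt ((a t / sqrt (1 - t\<^sup>2))\<^sup>2 - 1) = sqrt ((a t)\<^sup>2 - (1 - t\<^sup>2)) / sqrt (1 - t\<^sup>2)"
      using T by (simp add: power_divide real_sqrt_divide[symmetric] diff_divide_distrib)
    have s0: "sqrt ((1 / sqrt (1 - t\<^sup>2))\<^sup>2 - 1) = t / sqrt (1 - t\<^sup>2)"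
    proof -
      have "(1 / sqrt (1 - t\<^sup>2))\<^sup>2 - 1 = t\<^sup>2 / (1 - t\<^sup>2)"
        using T by (simp add: power_divide field_simps)
      then show ?thesis using t by (simp add: real_sqrt_divide)
    qed
    have "(a t)\<^sup>2 - (1 - t\<^sup>2) \<ge> 0"
      using ge(1) T at unfolding c1 by (simp add: real_le_lsqrt le_divide_eq sqrt_le_D real_sqrt_le_iff)
    then have A: "0 < a t + sqrt ((a t)\<^sup>2 - (1 - t\<^sup>2))" using at by (simp add: add_pos_nonneg)
    have "hdist x (t *\<^sub>R e) = ln ((a t + sqrt ((a t)\<^sup>2 - (1 - t\<^sup>2))) / sqrt (1 - t\<^sup>2))"
      unfolding hdist_eq arcosh_real_def[OF ge(1)] unfolding c1 s1 by (simp add: add_divide_distrib)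
    moreover have "hdist 0 (t *\<^sub>R e) = ln ((1 + t) / sqrt (1 - t\<^sup>2))"
      unfolding hdist_eq arcosh_real_def[OF ge(2)] unfolding c0 s0 by (simp add: add_divide_distrib)
    ultimately show ?thesis
      using A T t by (simp add: g_def ln_div)
  qed
  have a1: "a 1 = horofun e x" by (simp add: a_def horofun_def N_def)
  have a1p: "0 < a 1" unfolding a1 by (rule horofun_pos[OF e x])
  have "isCont a 1"
    unfolding a_def using N by (intro continuous_intros) auto
  then have "isCont g 1"
    unfolding g_def using a1p by (intro continuous_intros) simp_all
  then have "(g \<longlongrightarrow> g 1) (at_left 1)"
    by (simp add: isCont_def filterlim_at_split)
  moreover have "eventually (\<lambda>t. g t = hdist x (t *\<^sub>R e) - hdist 0 (t *\<^sub>R e)) (at_left (1::real))"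
    unfolding eventually_at_left_field using g_eq by (intro exI[of _ 0]) auto
  ultimately have "((\<lambda>t. hdist x (t *\<^sub>R e) - hdist 0 (t *\<^sub>R e)) \<longlongrightarrow> g 1) (at_left 1)"
    by (rule Lim_transform_eventually)
  then have "busemann e x = g 1"
    unfolding busemann_def by (intro tendsto_Lim) (auto simp: trivial_limit_at_left_real)
  also have "g 1 = ln (horofun e x)"
    using a1p by (simp add: g_def a1[symmetric])
  finally show ?thesis .
qed

lemma horoball_at_iff:
  fixes e :: "real^'n"
  assumes "norm e = 1"
  shows "horoball_at e B \<longleftrightarrow> (\<exists>k>0. B = horoball e k)"
proof -
  have eq: "{x \<in> hyp_space. busemann e x \<le> c} = horoball e (exp c)" for c
  proof -
    have "busemann e x \<le> c \<longleftrightarrow> horofun e x \<le> exp c" if "norm x < 1" for x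
      using busemann_eq_ln_horofun[OF assms that] horofun_pos[OF assms that]
      by (metis exp_le_cancel_iff exp_ln)
    then show ?thesis by (auto simp: horoball_def)
  qed
  show ?thesis
    unfolding horoball_at_def eq by (metis exp_gt_zero exp_ln)
qed

text \<open>
  Isometries preserve the normalised Minkowski product of interior points. Comparing with the
  origin removes the normalising square roots, so that the identity becomes polynomial in \<open>g x\<close>
  and \<open>g y\<close> and extends to ideal points by continuity. In particular isometries change the
  numbers \<open>1 - x \<bullet> y\<close> for ideal points only by a factor that is a product of a function of
  \<open>x\<close> and the same function of \<open>y\<close>.
\<close>

lemma isometry_gram:
  fixes g :: "real^'n \<Rightarrow> real^'n"
  assumes g: "hyp_isometry g" and x: "x \<in> hyp_closure" and y: "y \<in> hyp_closure"
  shows "(1 - g x \<bullet> g y) * (1 - (norm (g 0))\<^sup>2) = (1 - x \<bullet> y) * (1 - g x \<bullet> g 0) * (1 - g y \<bullet> g 0)"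
proof -
  have cont: "continuous_on hyp_closure g" and img: "g ` hyp_space = hyp_space"
    and iso: "\<And>x y. x \<in> hyp_space \<Longrightarrow> y \<in> hyp_space \<Longrightarrow> hdist (g x) (g y) = hdist x y"
    using g by (auto simp: hyp_isometry_def)
  have gn: "norm (g z) < 1" if "norm z < 1" for z
    using img that by (metis image_eqI mem_ball_0)
  have cd: "cosh_dist (g a) (g b) = cosh_dist a b" if "norm a < 1" "norm b < 1" for a b
  proof -
    have "cosh (hdist (g a) (g b)) = cosh (hdist a b)" using iso that by simp
    then show ?thesis using that gn by (simp add: hdist_eq cosh_dist_ge_1)
  qed
  define r where "r z = sqrt ((1 - (norm (g z))\<^sup>2) / (1 - (norm z)\<^sup>2))" for z
  have ratio: "1 - g a \<bullet> g b = (1 - a \<bullet> b) * (r a * r b)" if a: "norm a < 1" and b: "norm b < 1" for a b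
  proof -
    define A where "A = 1 - (norm a)\<^sup>2"
    define B where "B = 1 - (norm b)\<^sup>2"
    define A' where "A' = 1 - (norm (g a))\<^sup>2"
    define B' where "B' = 1 - (norm (g b))\<^sup>2"
    have pos: "0 < A" "0 < B" "0 < A'" "0 < B'"
      unfolding A_def B_def A'_def B'_def using a b gn norm_less_one_gap by blast+
    have "(1 - g a \<bullet> g b) / (sqrt A' * sqrt B') = (1 - a \<bullet> b) / (sqrt A * sqrt B)"
      using cd[OF a b] unfolding cosh_dist_def A_def B_def A'_def B'_def by (simp only: real_sqrt_mult)
    then have "1 - g a \<bullet> g b = (1 - a \<bullet> b) / (sqrt A * sqrt B) * (sqrt A' * sqrt B')"
      using pos by (simp add: field_simps)
    also have "\<dots> = (1 - a \<bullet> b) * (sqrt A' / sqrt A * (sqrt B' / sqrt B))" by simp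
    finally show ?thesis
      unfolding r_def A_def[symmetric] B_def[symmetric] A'_def[symmetric] B'_def[symmetric]
      by (simp only: real_sqrt_divide)
  qed
  have r0: "(r 0)\<^sup>2 = 1 - (norm (g 0))\<^sup>2"
    using norm_less_one_gap[OF gn[of 0]] by (simp add: r_def)
  have inside: "(1 - g a \<bullet> g b) * (1 - (norm (g 0))\<^sup>2) - (1 - a \<bullet> b) * (1 - g a \<bullet> g 0) * (1 - g b \<bullet> g 0) = 0"
    if a: "norm a < 1" and b: "norm b < 1" for a b
  proof -
    have "1 - g a \<bullet> g 0 = r a * r 0" "1 - g b \<bullet> g 0 = r b * r 0"
      using ratio[OF a, of 0] ratio[OF b, of 0] by simp_all
    then show ?thesis
      unfolding r0[symmetric] ratio[OF a b] by (simp only: power2_eq_square) simp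
  qed
  define h where "h p = (1 - g (fst p) \<bullet> g (snd p)) * (1 - (norm (g 0))\<^sup>2) -
     (1 - fst p \<bullet> snd p) * (1 - g (fst p) \<bullet> g 0) * (1 - g (snd p) \<bullet> g 0)" for p :: "(real^'n) \<times> (real^'n)"
  have "continuous_on (hyp_closure \<times> hyp_closure) h"
    unfolding h_def by (intro continuous_intros continuous_on_compose2[OF cont]) auto
  moreover have "closure (hyp_space \<times> hyp_space) = (hyp_closure \<times> hyp_closure :: ((real^'n) \<times> (real^'n)) set)"
    by (simp add: closure_Times)
  ultimately have cont_h: "continuous_on (closure (hyp_space \<times> hyp_space)) h"
    and mem: "(x, y) \<in> closure (hyp_space \<times> hyp_space)"
    using x y by simp_all
  have "h p = 0" if "p \<in> hyp_space \<times> hyp_space" for p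
  proof -
    have "norm (fst p) < 1" "norm (snd p) < 1" using that by (auto simp: mem_Times_iff)
    then show ?thesis unfolding h_def by (rule inside)
  qed
  from continuous_constant_on_closure[OF cont_h this mem] have "h (x, y) = 0" .
  then show ?thesis by (simp add: h_def)
qed

lemma isometry_sphere:
  fixes g :: "real^'n \<Rightarrow> real^'n"
  assumes g: "hyp_isometry g" and x: "norm x = 1" and le: "norm (g x) \<le> 1"
  shows "norm (g x) = 1"
proof -
  have g0: "norm (g 0) < 1" using g unfolding hyp_isometry_def
    by (metis centre_in_ball image_eqI mem_ball_0 zero_less_one)
  then have "0 < 1 - (norm (g 0))\<^sup>2" by (rule norm_less_one_gap)
  moreover have "(1 - g x \<bullet> g x) * (1 - (norm (g 0))\<^sup>2) = 0"
    using isometry_gram[OF g, of x x] x by (simp add: dot_square_norm)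
  ultimately show ?thesis by (simp add: dot_square_norm norm_eq_1)
qed

text \<open>
  The ball is strictly convex.
\<close>

lemma hull_inter_sphere:
  fixes S :: "(real^'n) set"
  assumes "S \<subseteq> hyp_boundary"
  shows "convex hull S \<inter> hyp_boundary = S"
proof
  show "convex hull S \<inter> hyp_boundary \<subseteq> S"
  proof
    fix x assume x: "x \<in> convex hull S \<inter> hyp_boundary"
    have sub: "convex hull S \<subseteq> cball 0 1"
      using assms by (intro hull_minimal) auto
    have "x extreme_point_of (convex hull S)"
      unfolding extreme_point_of_def
    proof (intro conjI ballI)
      fix a b assume ab: "a \<in> convex hull S" "b \<in> convex hull S"
      then have n: "norm a \<le> 1" "norm b \<le> 1" using sub by auto
      show "x \<notin> open_segment a b"
      proof
        assume "x \<in> open_segment a b"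
        have "dist 0 x < dist 0 a \<or> dist 0 x < dist 0 b"
          using \<open>x \<in> open_segment a b\<close> by (rule dist_decreases_open_segment)
        then show False using x n by simp
      qed
    qed (use x in auto)
    then show "x \<in> S" by (rule extreme_point_of_convex_hull)
  qed
  show "S \<subseteq> convex hull S \<inter> hyp_boundary" using assms by (auto intro: hull_inc)
qed

lemma ideal_simplex_symmetry:
  fixes E :: "nat \<Rightarrow> real^'n"
  assumes E: "ideal_simplex E" and g: "g \<in> symmetries (simplex_of E)"
  shows "g ` (E ` {..CARD('n)}) = E ` {..CARD('n)}"
proof -
  let ?V = "E ` {..CARD('n)}"
  have iso: "hyp_isometry g" and gT: "g ` simplex_of E = simplex_of E"
    using g by (auto simp: symmetries_def)
  have V: "simplex_of E \<inter> hyp_boundary = ?V"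
    using E unfolding ideal_simplex_def simplex_of_def by (intro hull_inter_sphere) simp
  have T: "simplex_of E \<subseteq> hyp_closure"
    unfolding simplex_of_def using E by (intro hull_minimal) (auto simp: ideal_simplex_def)
  have img: "g ` hyp_space = hyp_space" using iso by (simp add: hyp_isometry_def)
  show ?thesis
  proof
    show "g ` ?V \<subseteq> ?V"
    proof
      fix z assume "z \<in> g ` ?V"
      then obtain x where "x \<in> ?V" and zx: "z = g x" by blast
      then have "x \<in> simplex_of E \<inter> hyp_boundary" using V by simp
      then have x: "x \<in> simplex_of E" "norm x = 1" "z = g x" using zx by auto
      then have zT: "z \<in> simplex_of E" using gT by blast
      then have "norm z = 1"
        using isometry_sphere[OF iso x(2)] T x(3) by auto
      then show "z \<in> ?V" using zT V by auto
    qed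
    show "?V \<subseteq> g ` ?V"
    proof
      fix z assume z: "z \<in> ?V"
      then have "z \<in> simplex_of E" "norm z = 1" using V by auto
      then obtain x where x: "x \<in> simplex_of E" "z = g x" using gT by blast
      have "norm x = 1"
      proof (rule ccontr)
        assume "norm x \<noteq> 1"
        then have "x \<in> hyp_space" using x T by force
        then have "z \<in> hyp_space" using img x by blast
        then show False using \<open>norm z = 1\<close> by simp
      qed
      then have "x \<in> ?V" using V x by auto
      then show "z \<in> g ` ?V" using x by blast
    qed
  qed
qed

lemma edge_face:
  fixes E :: "nat \<Rightarrow> real^'n"
  assumes E: "ideal_simplex E" and ij: "i \<le> CARD('n)" "j \<le> CARD('n)" "i \<noteq> j"
  shows "convex hull {E i, E j} face_of simplex_of E" "aff_dim (convex hull {E i, E j}) = 1"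
    "convex hull {E i, E j} \<inter> hyp_boundary = {E i, E j}"
proof -
  have ne: "E i \<noteq> E j" using E ij by (auto simp: ideal_simplex_def inj_on_def)
  show "convex hull {E i, E j} face_of simplex_of E"
    using E ij unfolding simplex_of_def ideal_simplex_def
    by (subst face_of_convex_hull_affine_independent) (auto intro!: exI[of _ "{E i, E j}"])
  show "aff_dim (convex hull {E i, E j}) = 1"
    using ne by (simp add: aff_dim_convex_hull aff_dim_2)
  show "convex hull {E i, E j} \<inter> hyp_boundary = {E i, E j}"
    using E ij by (intro hull_inter_sphere) (auto simp: ideal_simplex_def)
qed

lemma edge_transitive:
  fixes E :: "nat \<Rightarrow> real^'n"
  assumes E: "ideal_simplex E" and reg: "regular_simplex E" and n: "CARD('n) \<ge> 2"
    and ij: "i \<le> CARD('n)" "j \<le> CARD('n)" "i \<noteq> j"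
    and kl: "k \<le> CARD('n)" "l \<le> CARD('n)" "k \<noteq> l"
  obtains g where "g \<in> symmetries (simplex_of E)" "g ` {E i, E j} = {E k, E l}"
proof -
  have "\<exists>g\<in>symmetries (simplex_of E). g ` (convex hull {E i, E j}) = convex hull {E k, E l}"
    using reg n edge_face[OF E ij] edge_face[OF E kl] unfolding regular_simplex_def
    by (metis (no_types, lifting) One_nat_def Suc_1 Suc_le_lessD of_nat_1)
  then obtain g where g: "g \<in> symmetries (simplex_of E)"
      "g ` (convex hull {E i, E j}) = convex hull {E k, E l}" by blast
  have V: "g ` (E ` {..CARD('n)}) = E ` {..CARD('n)}"
    by (rule ideal_simplex_symmetry[OF E g(1)])
  have inj: "inj_on g (E ` {..CARD('n)})"
    using V by (intro eq_card_imp_inj_on) simp_all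
  have "g ` {E i, E j} \<subseteq> convex hull {E k, E l}"
    using g(2) by (auto intro: hull_inc)
  moreover have "g ` {E i, E j} \<subseteq> E ` {..CARD('n)}"
    using V ij by blast
  then have "g ` {E i, E j} \<subseteq> hyp_boundary" using E by (auto simp: ideal_simplex_def)
  ultimately have sub: "g ` {E i, E j} \<subseteq> {E k, E l}" using edge_face(3)[OF E kl] by blast
  have "E i \<noteq> E j" using E ij by (auto simp: ideal_simplex_def inj_on_def)
  moreover have "E k \<noteq> E l" using E kl by (auto simp: ideal_simplex_def inj_on_def)
  moreover have "g (E i) \<noteq> g (E j)"
    using inj ij calculation(1) by (auto simp: inj_on_def)
  ultimately have "g ` {E i, E j} = {E k, E l}" using sub by auto
  then show ?thesis using g(1) that by blast
qed

text \<open>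
  The vertices can be rescaled to null vectors \<open>w i *\<^sub>R (E i, 1)\<close> whose mutual Minkowski
  products are all \<open>- 2\<close>; equivalently, the horoballs of levels \<open>1 / w i\<close> are pairwise tangent.

  Symmetries change the logarithms of the numbers \<open>1 - x \<bullet> y\<close> only by terms \<open>b x + b y\<close>.
  The function \<open>f\<close> below removes this ambiguity by subtracting a multiple of the row sums \<open>D\<close>:
  it is invariant under symmetries, hence constant on the edges by transitivity on edges.
\<close>

lemma regular_ideal_simplex_weights:
  fixes E :: "nat \<Rightarrow> real^'n"
  assumes E: "ideal_simplex E" and reg: "regular_simplex E" and n: "CARD('n) \<ge> 2"
  obtains w :: "nat \<Rightarrow> real" where "\<And>i. 0 < w i"
    and "\<And>i j. i \<le> CARD('n) \<Longrightarrow> j \<le> CARD('n) \<Longrightarrow> i \<noteq> j \<Longrightarrow> w i * w j * (1 - E i \<bullet> E j) = 2"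
proof -
  let ?n = "CARD('n)"
  have nE: "norm (E i) = 1" if "i \<le> ?n" for i using E that by (auto simp: ideal_simplex_def)
  have injE: "inj_on E {..?n}" using E by (simp add: ideal_simplex_def)
  have pos: "0 < 1 - E i \<bullet> E j" if "i \<le> ?n" "j \<le> ?n" "i \<noteq> j" for i j
    using inner_less_one_sphere[OF nE nE] that injE by (force simp: inj_on_def)
  define D where "D x = (\<Sum>z\<in>E ` {..?n} - {x}. ln (1 - x \<bullet> z))" for x
  define f where "f x y = ln (1 - x \<bullet> y) - (D x + D y) / (real ?n - 1)" for x y
  have inv: "f (g x) (g y) = f x y"
    if g: "g \<in> symmetries (simplex_of E)" and x: "x \<in> E ` {..?n}" and y: "y \<in> E ` {..?n}" and ne: "x \<noteq> y" for g x y
  proof -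
    let ?V = "E ` {..?n}"
    have V: "g ` ?V = ?V" by (rule ideal_simplex_symmetry[OF E g])
    have inj: "inj_on g ?V" using V by (intro eq_card_imp_inj_on) simp_all
    have iso: "hyp_isometry g" using g by (simp add: symmetries_def)
    have g0: "norm (g 0) < 1" using iso unfolding hyp_isometry_def
      by (metis centre_in_ball image_eqI mem_ball_0 zero_less_one)
    have nV: "norm z = 1" if "z \<in> ?V" for z using that nE by auto
    have gV: "g z \<in> ?V" if "z \<in> ?V" for z using that V by blast
    have posV: "0 < 1 - a \<bullet> b" if "a \<in> ?V" "b \<in> ?V" "a \<noteq> b" for a b
      using inner_less_one_sphere[OF nV nV, of a b] that by simp
    define c where "c = 1 - (norm (g 0))\<^sup>2"
    have c: "0 < c" unfolding c_def using norm_less_one_gap[OF g0] .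
    define b where "b z = ln (1 - g z \<bullet> g 0) - ln c / 2" for z
    have step: "ln (1 - g a \<bullet> g z) = ln (1 - a \<bullet> z) + b a + b z" if a: "a \<in> ?V" and z: "z \<in> ?V" and az: "a \<noteq> z" for a z
    proof -
      have p: "0 < 1 - a \<bullet> z" using posV a z az .
      have q: "0 < 1 - g u \<bullet> g 0" if "u \<in> ?V" for u
        using inner_less_one[OF g0, of "g u"] nV[OF gV[OF that]] by (simp add: inner_commute)
      have r: "0 < 1 - g a \<bullet> g z" using posV gV a z az inj by (metis inj_onD)
      have "(1 - g a \<bullet> g z) * c = (1 - a \<bullet> z) * (1 - g a \<bullet> g 0) * (1 - g z \<bullet> g 0)"
        unfolding c_def using nV a z by (intro isometry_gram[OF iso]) simp_all
      then have "ln ((1 - g a \<bullet> g z) * c) = ln ((1 - a \<bullet> z) * (1 - g a \<bullet> g 0) * (1 - g z \<bullet> g 0))"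
        by simp
      then show ?thesis using p q[OF a] q[OF z] r c by (simp add: ln_mult b_def)
    qed
    define B where "B = (\<Sum>z\<in>?V. b z)"
    have cV: "card ?V = ?n + 1" using injE by (simp add: card_image)
    have Dg: "D (g a) = D a + (real ?n - 1) * b a + B" if a: "a \<in> ?V" for a
    proof -
      have "?V - {g a} = g ` (?V - {a})"
        using inj_on_image_set_diff[OF inj, of ?V "{a}"] V a by auto
      then have "D (g a) = (\<Sum>z\<in>?V - {a}. ln (1 - g a \<bullet> g z))"
        unfolding D_def using inj by (simp add: sum.reindex inj_on_diff)
      also have "\<dots> = (\<Sum>z\<in>?V - {a}. ln (1 - a \<bullet> z) + b a + b z)"
        using step a by (intro sum.cong) auto
      also have "\<dots> = D a + real ?n * b a + (B - b a)"
        using a cV by (simp add: sum.distrib D_def B_def sum_diff1)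
      finally show ?thesis by (simp add: algebra_simps)
    qed
    \<comment> \<open>The total of the row sums is invariant, which forces the sum of the \<open>b z\<close> to vanish.\<close>
    have "(\<Sum>z\<in>?V. D (g z)) = (\<Sum>z\<in>g ` ?V. D z)"
      using inj by (simp add: sum.reindex)
    then have "(\<Sum>z\<in>?V. D z) = (\<Sum>z\<in>?V. D z + (real ?n - 1) * b z + B)"
      using V Dg by simp
    then have "0 = (real ?n - 1) * B + (real ?n + 1) * B"
      using cV by (simp add: sum.distrib sum_distrib_left[symmetric] B_def add.commute)
    then have "B = 0" by (simp add: algebra_simps)
    then show ?thesis
      using Dg[OF x] Dg[OF y] step[OF x y ne] n
      by (simp add: f_def field_simps)
  qed
  define F where "F = f (E 0) (E 1)"
  have f_sym: "f x y = f y x" for x y by (simp add: f_def inner_commute)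
  have const: "f (E i) (E j) = F" if ij: "i \<le> ?n" "j \<le> ?n" "i \<noteq> j" for i j
  proof -
    have "(0::nat) \<le> ?n" "(1::nat) \<le> ?n" "(0::nat) \<noteq> 1" using n by auto
    from edge_transitive[OF E reg n this ij]
    obtain g where g: "g \<in> symmetries (simplex_of E)" "g ` {E 0, E 1} = {E i, E j}" by blast
    have "E 0 \<noteq> E 1" using inj_onD[OF injE, of 0 1] n by auto
    then have "f (g (E 0)) (g (E 1)) = F"
      unfolding F_def using n by (intro inv g) auto
    moreover have "g (E 0) = E i \<and> g (E 1) = E j \<or> g (E 0) = E j \<and> g (E 1) = E i"
      using g(2) by (auto simp: doubleton_eq_iff)
    ultimately show ?thesis using f_sym by auto
  qed
  define w where "w i = sqrt 2 * exp (- F / 2 - D (E i) / (real ?n - 1))" for i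
  show ?thesis
  proof
    show "0 < w i" for i by (simp add: w_def)
    show "w i * w j * (1 - E i \<bullet> E j) = 2" if ij: "i \<le> ?n" "j \<le> ?n" "i \<noteq> j" for i j
    proof -
      define u where "u i = - F / 2 - D (E i) / (real ?n - 1)" for i
      have "sqrt 2 * a * (sqrt 2 * b) * c = 2 * (a * b * c)" for a b c :: real
        by (simp add: ac_simps)
      then have "w i * w j * (1 - E i \<bullet> E j) = 2 * (exp (u i) * exp (u j) * exp (ln (1 - E i \<bullet> E j)))"
        using pos[OF ij] unfolding w_def u_def by (simp only: exp_ln)
      also have "\<dots> = 2 * exp (u i + u j + ln (1 - E i \<bullet> E j))"
        by (simp only: exp_add)
      also have "u i + u j + ln (1 - E i \<bullet> E j) = 0"
        using const[OF ij] by (simp add: f_def u_def add_divide_distrib)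
      finally show ?thesis by simp
    qed
  qed
qed

section \<open>The extremal problem for the scales\<close>

lemma power_ge_quadratic:
  fixes x :: real
  assumes "0 \<le> x"
  shows "1 + real m * x + real m * (real m - 1) / 2 * x\<^sup>2 \<le> (1 + x) ^ m"
proof (induction m)
  case (Suc m)
  have "1 + real (Suc m) * x + real (Suc m) * (real (Suc m) - 1) / 2 * x\<^sup>2 \<le>
     (1 + x) * (1 + real m * x + real m * (real m - 1) / 2 * x\<^sup>2)"
  proof -
    have "0 \<le> real m * (real m - 1) / 2"
      by (cases m) auto
    then have "0 \<le> real m * (real m - 1) / 2 * x ^ 3" using assms by simp
    then show ?thesis by (simp add: algebra_simps power2_eq_square power3_eq_cube add_divide_distrib diff_divide_distrib)
  qed
  also have "\<dots> \<le> (1 + x) * (1 + x) ^ m"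
    using Suc assms by (intro mult_left_mono) auto
  finally show ?case by simp
qed simp

lemma square_le_two_power:
  assumes "2 \<le> m"
  shows "(real m + 1)\<^sup>2 \<le> 9 / 4 * 2 ^ m"
  using assms
proof (induction m rule: dec_induct)
  case (step m)
  have "(real (Suc m) + 1)\<^sup>2 \<le> 2 * (real m + 1)\<^sup>2"
  proof -
    have "2 * 2 \<le> real m * real m" using step by (intro mult_mono) auto
    then show ?thesis by (simp add: power2_eq_square algebra_simps)
  qed
  also have "\<dots> \<le> 2 * (9 / 4 * 2 ^ m)" using step by simp
  finally show ?case by simp
qed simp

text \<open>
  Equality holds for \<open>n = 3\<close>. With \<open>m = n - 1\<close> the square of the right-hand side is
  \<open>2 ^ m * (1 + 1 / m) ^ m\<close>, and already the first three terms of the binomial expansion give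
  \<open>(1 + 1 / m) ^ m \<ge> 9 / 4\<close>.
\<close>

lemma critical_scale_ge:
  assumes n: "3 \<le> n"
  shows "real n \<le> sqrt (2 * real n / (real n - 1)) ^ (n - 1)"
proof -
  define m where "m = n - 1"
  have m: "2 \<le> m" "real n = real m + 1" using n by (auto simp: m_def of_nat_diff)
  have m0: "real m > 0" using m by simp
  have "(real n)\<^sup>2 \<le> 2 ^ m * (9 / 4)"
    using square_le_two_power[OF m(1)] m by simp
  also have "\<dots> \<le> 2 ^ m * (1 + 1 / real m) ^ m"
  proof -
    have "9 / 4 \<le> 1 + real m * (1 / real m) + real m * (real m - 1) / 2 * (1 / real m)\<^sup>2"
      using m m0 by (simp add: field_simps power2_eq_square)
    also have "\<dots> \<le> (1 + 1 / real m) ^ m" by (rule power_ge_quadratic) simp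
    finally show ?thesis by simp
  qed
  also have "\<dots> = (2 * real n / (real n - 1)) ^ m"
    using m0 by (simp add: m(2) power_mult_distrib[symmetric] field_simps)
  finally have "sqrt ((real n)\<^sup>2) \<le> sqrt ((2 * real n / (real n - 1)) ^ m)"
    by (rule real_sqrt_le_mono)
  then show ?thesis by (simp add: real_sqrt_power m_def)
qed

text \<open>
  The function \<open>t + c / t\<close> is convex with equal values at \<open>T\<close> and \<open>c / T\<close>, and
  \<open>c / T \<le> 1 \<le> t \<le> T\<close>.
\<close>

lemma reciprocal_sum_mono:
  fixes t T c :: real
  assumes "1 \<le> t" "t \<le> T" "c \<le> T" "0 \<le> c"
  shows "t + c / t \<le> T + c / T"
proof -
  have "c \<le> t * T" using assms mult_mono[of 1 t c T] by simp
  then have "0 \<le> (T - t) * (t * T - c)" using assms by simp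
  then show ?thesis using assms by (simp add: field_simps power2_eq_square)
qed

text \<open>
  At most one of the \<open>t i\<close> exceeds \<open>1\<close>; all the others are at most its reciprocal. If there is
  none, the value \<open>1\<close> takes its place in the estimate.
\<close>

lemma sum_le_of_pairwise_product_le_one:
  fixes t :: "nat \<Rightarrow> real"
  assumes T: "real n \<le> T" "1 \<le> T"
    and pos: "\<And>i. i \<le> n \<Longrightarrow> 0 < t i" and le: "\<And>i. i \<le> n \<Longrightarrow> t i \<le> T"
    and prod: "\<And>i j. i \<le> n \<Longrightarrow> j \<le> n \<Longrightarrow> i \<noteq> j \<Longrightarrow> t i * t j \<le> 1"
  shows "(\<Sum>i\<le>n. t i) \<le> T + real n / T"
proof (cases "\<forall>i\<le>n. t i \<le> 1")
  case True
  have "(\<Sum>i\<le>n. t i) \<le> (\<Sum>i\<le>n. 1)" by (intro sum_mono) (use True in auto)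
  also have "\<dots> = 1 + real n / 1" by simp
  also have "\<dots> \<le> T + real n / T" using T by (intro reciprocal_sum_mono) auto
  finally show ?thesis .
next
  case False
  then obtain m where m: "m \<le> n" "1 < t m" by (auto simp: not_le)
  have "(\<Sum>i\<le>n. t i) = t m + (\<Sum>i\<in>{..n} - {m}. t i)"
    using m by (simp add: sum.remove)
  also have "(\<Sum>i\<in>{..n} - {m}. t i) \<le> (\<Sum>i\<in>{..n} - {m}. 1 / t m)"
    using prod[OF _ m(1)] m by (intro sum_mono) (auto simp: field_simps)
  also have "\<dots> = real n / t m" using m by simp
  also have "t m + real n / t m \<le> T + real n / T"
    using m T le by (intro reciprocal_sum_mono) auto
  finally show ?thesis by simp
qed

lemma telescoping_product:
  "2 \<le> n \<Longrightarrow> (\<Prod>k=2..n. (real k - 1) / (real k + 1)) = 2 / (real n * (real n + 1))"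
proof (induction n rule: dec_induct)
  case (step n)
  then have "(\<Prod>k=2..Suc n. (real k - 1) / (real k + 1)) =
     2 / (real n * (real n + 1)) * (real n / (real n + 2))"
    by (simp add: prod.nat_ivl_Suc' mult.commute)
  also have "\<dots> = (real n * 2) / (real n * ((real n + 1) * (real n + 2)))"
    by (simp add: ac_simps)
  also have "\<dots> = 2 / ((real n + 1) * (real n + 2))"
    using step by (intro mult_divide_mult_cancel_left) simp
  finally show ?case by (simp add: add.commute)
qed simp

lemma sqrt_prod: "sqrt (\<Prod>k\<in>A. f k) = (\<Prod>k\<in>A. sqrt (f k))"
  by (induction A rule: infinite_finite_induct) (simp_all add: real_sqrt_mult)

text \<open>
  The right-hand side differs from the Euclidean volume of a regular simplex with unit edges in
  dimension \<open>n - 1\<close> only by elementary factors. Passing from \<open>n\<close> to \<open>n + 1\<close> multiplies the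
  product by the square root of a telescoping product.
\<close>

lemma simplex_product_formula:
  "2 \<le> n \<Longrightarrow> (\<Prod>k=2..n-1. ((real k - 1) / (real k + 1)) powr ((real n - real k) / 2)) =
     sqrt 2 ^ (n - 1) / (sqrt (real n) * fact (n - 1))"
proof (induction n rule: dec_induct)
  case (step n)
  let ?q = "\<lambda>k. (real k - 1) / (real k + 1)"
  have q: "0 < ?q k" if "k \<in> {2..n}" for k using that by simp
  have split: "{2..n} = insert n {2..n-1}" using step by auto
  have "(\<Prod>k=2..Suc n - 1. ?q k powr ((real (Suc n) - real k) / 2)) =
     (\<Prod>k=2..n. ?q k powr ((real n - real k) / 2) * ?q k powr (1 / 2))"
    by (intro prod.cong) (auto simp: powr_add[symmetric] add_divide_distrib[symmetric] algebra_simps)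
  also have "\<dots> = (\<Prod>k=2..n. ?q k powr ((real n - real k) / 2)) * (\<Prod>k=2..n. ?q k powr (1 / 2))"
    by (rule prod.distrib)
  also have "(\<Prod>k=2..n. ?q k powr ((real n - real k) / 2)) = (\<Prod>k=2..n-1. ?q k powr ((real n - real k) / 2))"
    unfolding split using step by (subst prod.insert) auto
  also have "(\<Prod>k=2..n. ?q k powr (1 / 2)) = sqrt (\<Prod>k=2..n. ?q k)"
  proof -
    have "(\<Prod>k=2..n. ?q k powr (1 / 2)) = (\<Prod>k=2..n. sqrt (?q k))"
      by (intro prod.cong powr_half_sqrt less_imp_le q) auto
    then show ?thesis by (simp only: sqrt_prod)
  qed
  also have "(\<Prod>k=2..n. ?q k) = 2 / (real n * (real n + 1))"
    using step by (intro telescoping_product) simp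
  also have "sqrt (2 / (real n * (real n + 1))) = sqrt 2 / (sqrt (real n) * sqrt (real n + 1))"
    by (simp add: real_sqrt_divide real_sqrt_mult)
  also have "(\<Prod>k=2..n-1. ?q k powr ((real n - real k) / 2)) * (sqrt 2 / (sqrt (real n) * sqrt (real n + 1))) =
     sqrt 2 ^ (Suc n - 1) / (sqrt (real (Suc n)) * fact (Suc n - 1))"
  proof -
    have n: "n = Suc (n - 1)" using step by simp
    have f: "(fact n :: real) = real n * fact (n - 1)" using step by (intro fact_reduce) simp
    have s: "sqrt 2 ^ n = sqrt 2 * sqrt 2 ^ (n - 1)" using step by (simp add: power_eq_if)
    have r: "real n = sqrt (real n) * sqrt (real n)" by simp
    have "sqrt 2 ^ (n - 1) / (sqrt (real n) * fact (n - 1)) * (sqrt 2 / (sqrt (real n) * sqrt (real n + 1))) =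
      sqrt 2 ^ n / (sqrt (real n + 1) * ((sqrt (real n) * sqrt (real n)) * fact (n - 1)))"
      unfolding s by (simp add: ac_simps)
    also have "\<dots> = sqrt 2 ^ n / (sqrt (real n + 1) * fact n)" by (simp add: f)
    finally show ?thesis
      unfolding step.IH by (simp only: diff_Suc_1 of_nat_Suc add.commute[of 1])
  qed
  finally show ?case .
qed simp

section \<open>Packing, tangency and the optimal arrangement\<close>

lemma small_step:
  fixes r m :: real
  assumes "0 < r" "0 \<le> m"
  shows "0 < r / (2 * (m + 1))" "r / (2 * (m + 1)) * m < r"
proof -
  have m: "0 < 2 * (m + 1)" using assms by simp
  then show "0 < r / (2 * (m + 1))" using assms by simp
  have "r * m < r * (2 * (m + 1))" using assms by (intro mult_strict_left_mono) auto
  then show "r / (2 * (m + 1)) * m < r" using m by (simp add: pos_divide_less_eq)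
qed

text \<open>
  In Minkowski space, split the point \<open>(x, 1)\<close> into its part in the plane of the null vectors
  \<open>(e, 1)\<close> and \<open>(f, 1)\<close> and the rest \<open>(z, z \<bullet> e)\<close>. The rest is orthogonal to a null vector and
  therefore not timelike, which is the Cauchy-Schwarz inequality for \<open>z\<close> and \<open>e\<close>.
\<close>

lemma horofun_product_ge:
  fixes e f x :: "real^'n"
  assumes e: "norm e = 1" and f: "norm f = 1" and ne: "e \<noteq> f" and x: "norm x < 1"
  shows "(1 - e \<bullet> f) / 2 \<le> horofun e x * horofun f x"
proof -
  define c where "c = 1 - e \<bullet> f"
  have c: "0 < c" using inner_less_one_sphere[OF e f ne] by (simp add: c_def)
  define p where "p = 1 - x \<bullet> e"
  define q where "q = 1 - x \<bullet> f"
  define N where "N = 1 - (norm x)\<^sup>2"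
  have N: "0 < N" using norm_less_one_gap[OF x] by (simp add: N_def)
  have ee: "e \<bullet> e = 1" "f \<bullet> f = 1" using e f by (simp_all add: norm_eq_1)
  have ip: "x \<bullet> e = 1 - p" "x \<bullet> f = 1 - q" "e \<bullet> f = 1 - c" "f \<bullet> e = 1 - c" "e \<bullet> x = 1 - p" "f \<bullet> x = 1 - q"
    by (simp_all add: p_def q_def c_def inner_commute)
  \<comment> \<open>The coefficients of the orthogonal projection to the plane of the two null vectors.\<close>
  define a where "a = q / c"
  define b where "b = p / c"
  have qa: "q = a * c" and pb: "p = b * c" using c by (simp_all add: a_def b_def)
  have xx: "x \<bullet> x = 1 - N" by (simp add: N_def power2_norm_eq_inner)
  define z where "z = x - a *\<^sub>R e - b *\<^sub>R f"
  have ze: "z \<bullet> e = 1 - a - b"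
    by (simp add: z_def inner_diff_left ee ip pb algebra_simps)
  have "(z \<bullet> e)\<^sup>2 \<le> z \<bullet> z"
    using Cauchy_Schwarz_ineq[of z e] by (simp add: ee)
  also have "z \<bullet> z = 1 - N + a * a + b * b - 2 * a * (1 - p) - 2 * b * (1 - q) + 2 * a * b * (1 - c)"
    by (simp add: z_def inner_diff_left inner_diff_right ee ip xx algebra_simps)
  finally have "0 \<le> 2 * a * b * c - N"
    unfolding ze qa pb by (simp add: power2_eq_square algebra_simps)
  also have "2 * a * b * c = 2 * p * q / c" using c by (simp add: qa pb)
  finally have "N * c \<le> 2 * p * q" using c by (simp add: field_simps)
  moreover have "horofun e x * horofun f x = p * q / N"
    using N by (simp add: horofun_def p_def q_def N_def[symmetric])
  then have "2 * p * q = N * (2 * (horofun e x * horofun f x))" using N by simp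
  ultimately have "N * c \<le> N * (2 * (horofun e x * horofun f x))" by simp
  then have "c \<le> 2 * (horofun e x * horofun f x)" using N by (simp only: mult_le_cancel_left_pos)
  then show ?thesis by (simp add: c_def)
qed

lemma horofun_decreases_toward_ideal_center:
  fixes e x :: "real^'n"
  assumes e: "norm e = 1" and x: "norm x < 1" and t: "0 < t" "t < 1"
  shows "norm (x + t *\<^sub>R (e - x)) < 1" "horofun e (x + t *\<^sub>R (e - x)) < horofun e x"
proof -
  define p where "p = 1 - x \<bullet> e"
  define N where "N = 1 - (norm x)\<^sup>2"
  have N: "0 < N" using norm_less_one_gap[OF x] by (simp add: N_def)
  have p: "0 < p" using inner_less_one[OF x, of e] e by (simp add: p_def)
  have ee: "e \<bullet> e = 1" using e by (simp add: norm_eq_1)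
  have xx: "x \<bullet> x = 1 - N" by (simp add: N_def power2_norm_eq_inner)
  have ip: "x \<bullet> e = 1 - p" "e \<bullet> x = 1 - p" by (simp_all add: p_def inner_commute)
  let ?y = "x + t *\<^sub>R (e - x)"
  have N': "1 - (norm ?y)\<^sup>2 = (1 - t)\<^sup>2 * N + 2 * t * (1 - t) * p"
    unfolding power2_norm_eq_inner
    by (simp add: inner_add_left inner_add_right inner_diff_left inner_diff_right ee xx ip power2_eq_square algebra_simps)
  have p': "1 - ?y \<bullet> e = (1 - t) * p"
    by (simp add: inner_add_left inner_diff_left ee ip algebra_simps)
  have "0 < (1 - t)\<^sup>2 * N + 2 * t * (1 - t) * p"
    using t N p by (intro add_pos_pos mult_pos_pos) auto
  then show y: "norm ?y < 1"
    unfolding N'[symmetric] by (rule gap_pos_norm_less_one)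
  have h: "horofun e x = p / sqrt N" by (simp add: horofun_def p_def N_def)
  have "((1 - t) * p)\<^sup>2 < (p / sqrt N)\<^sup>2 * ((1 - t)\<^sup>2 * N + 2 * t * (1 - t) * p)"
  proof -
    have "(p / sqrt N)\<^sup>2 * ((1 - t)\<^sup>2 * N + 2 * t * (1 - t) * p) =
        ((1 - t) * p)\<^sup>2 + p\<^sup>2 / N * (2 * t * (1 - t) * p)"
    proof -
      have "(p / sqrt N)\<^sup>2 = p\<^sup>2 / N" using N by (simp add: power_divide)
      moreover have "p\<^sup>2 / N * ((1 - t)\<^sup>2 * N) = ((1 - t) * p)\<^sup>2"
        using N by (simp add: power_mult_distrib)
      ultimately show ?thesis by (simp only: distrib_left)
    qed
    moreover have "0 < p\<^sup>2 / N * (2 * t * (1 - t) * p)"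
      using t N p by (intro mult_pos_pos divide_pos_pos) auto
    ultimately show ?thesis by simp
  qed
  then show "horofun e ?y < horofun e x"
    using horofun_less_iff[OF e y horofun_pos[OF e x]] by (simp add: h N' p')
qed

lemma open_strict_horoball: "open {x \<in> hyp_space. horofun e x < k}"
proof -
  have "open (hyp_space \<inter> horofun e -` {..<k})"
    by (intro continuous_open_preimage continuous_on_horofun) auto
  moreover have "{x \<in> hyp_space. horofun e x < k} = hyp_space \<inter> horofun e -` {..<k}" by auto
  ultimately show ?thesis by simp
qed

text \<open>
  The product of the two level functions has minimum \<open>(1 - e \<bullet> f) / 2\<close>, attained on the geodesic
  from \<open>e\<close> to \<open>f\<close>. If the product of the levels is at most this, a common interior point could be
  moved towards \<open>e\<close>, which would make the product too small. Otherwise some point of the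
  geodesic lies strictly inside both horoballs.
\<close>

lemma disjoint_horoballs_iff:
  fixes e f :: "real^'n"
  assumes e: "norm e = 1" and f: "norm f = 1" and ne: "e \<noteq> f" and k: "0 < k" and l: "0 < l"
  shows "interior (horoball e k) \<inter> interior (horoball f l) = {} \<longleftrightarrow> 2 * k * l \<le> 1 - e \<bullet> f"
proof
  assume le: "2 * k * l \<le> 1 - e \<bullet> f"
  show "interior (horoball e k) \<inter> interior (horoball f l) = {}"
  proof (rule ccontr)
    assume "interior (horoball e k) \<inter> interior (horoball f l) \<noteq> {}"
    then obtain x where x: "x \<in> interior (horoball e k) \<inter> interior (horoball f l)" by blast
    have "open (interior (horoball e k) \<inter> interior (horoball f l))" by blast
    then obtain r where r: "0 < r" "ball x r \<subseteq> interior (horoball e k) \<inter> interior (horoball f l)"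
      using x by (meson open_contains_ball)
    have xk: "norm x < 1" "horofun e x \<le> k"
      using x interior_subset by (auto simp: horoball_def)
    define t where "t = min (1/2) (r / (2 * (norm (e - x) + 1)))"
    have "0 < r / (2 * (norm (e - x) + 1))"
      using r by (intro small_step) auto
    then have t: "0 < t" "t < 1" by (auto simp: t_def min_less_iff_disj)
    have "t * norm (e - x) < r"
    proof -
      have "t * norm (e - x) \<le> r / (2 * (norm (e - x) + 1)) * norm (e - x)"
        by (intro mult_right_mono) (auto simp: t_def)
      also have "\<dots> < r" using r by (intro small_step) auto
      finally show ?thesis .
    qed
    then have "x + t *\<^sub>R (e - x) \<in> ball x r" using t by (simp add: dist_norm)
    then have y: "x + t *\<^sub>R (e - x) \<in> horoball f l" using r interior_subset by blast
    let ?y = "x + t *\<^sub>R (e - x)"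
    have yn: "norm ?y < 1" and yl: "horofun f ?y \<le> l" using y by (auto simp: horoball_def)
    have "horofun e ?y < k" using horofun_decreases_toward_ideal_center(2)[OF e xk(1) t] xk(2) by simp
    then have "horofun e ?y * horofun f ?y < k * l"
      using yl horofun_pos[OF e yn] horofun_pos[OF f yn] by (intro mult_less_le_imp_less) auto
    then show False using horofun_product_ge[OF e f ne yn] le by simp
  qed
next
  assume disj: "interior (horoball e k) \<inter> interior (horoball f l) = {}"
  show "2 * k * l \<le> 1 - e \<bullet> f"
  proof (rule ccontr)
    define c where "c = 1 - e \<bullet> f"
    have c: "0 < c" using inner_less_one_sphere[OF e f ne] by (simp add: c_def)
    assume "\<not> 2 * k * l \<le> 1 - e \<bullet> f"
    then have kl: "c < 2 * k * l" by (simp add: c_def)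
    have ee: "e \<bullet> e = 1" "f \<bullet> f = 1" "e \<bullet> f = 1 - c" "f \<bullet> e = 1 - c"
      using e f by (simp_all add: norm_eq_1 c_def inner_commute)
    \<comment> \<open>The point of the geodesic at which the two level functions are in the ratio of the levels \<open>k\<close> and \<open>l\<close>.\<close>
    define x where "x = (1 / (l + k)) *\<^sub>R (l *\<^sub>R e + k *\<^sub>R f)"
    have s: "0 < l + k" using k l by simp
    have xe: "1 - x \<bullet> e = k * c / (l + k)" "1 - x \<bullet> f = l * c / (l + k)"
    proof -
      have "x \<bullet> e = ((l + k) - k * c) / (l + k)" "x \<bullet> f = ((l + k) - l * c) / (l + k)"
        by (simp_all add: x_def inner_add_left ee add_divide_distrib[symmetric]) (simp_all add: algebra_simps)
      then show "1 - x \<bullet> e = k * c / (l + k)" "1 - x \<bullet> f = l * c / (l + k)"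
        using s by (simp_all only: diff_divide_distrib) simp_all
    qed
    have xx: "1 - (norm x)\<^sup>2 = 2 * l * k * c / (l + k)\<^sup>2"
    proof -
      have "(norm x)\<^sup>2 = (norm (l *\<^sub>R e + k *\<^sub>R f))\<^sup>2 / (l + k)\<^sup>2"
        using s by (simp add: x_def power_divide)
      also have "(norm (l *\<^sub>R e + k *\<^sub>R f))\<^sup>2 = (l + k)\<^sup>2 - 2 * l * k * c"
        unfolding power2_norm_eq_inner
        by (simp add: inner_add_left inner_add_right ee power2_eq_square algebra_simps)
      finally show ?thesis using s by (simp add: diff_divide_distrib)
    qed
    have "0 < 1 - (norm x)\<^sup>2" unfolding xx using k l c s by simp
    then have xn: "norm x < 1" by (rule gap_pos_norm_less_one)
    have "(k * c / (l + k))\<^sup>2 < k\<^sup>2 * (2 * l * k * c / (l + k)\<^sup>2)"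
    proof -
      have "(k * c) * (k * c) < (k * c) * (k * (2 * k * l))" using kl k c by simp
      then have "(k * c)\<^sup>2 < k\<^sup>2 * (2 * l * k * c)" by (simp add: power2_eq_square ac_simps)
      then show ?thesis using s by (simp add: power_divide divide_strict_right_mono)
    qed
    then have "horofun e x < k" using horofun_less_iff[OF e xn k] by (simp add: xe xx)
    moreover have "(l * c / (l + k))\<^sup>2 < l\<^sup>2 * (2 * l * k * c / (l + k)\<^sup>2)"
    proof -
      have "(l * c) * (l * c) < (l * c) * (l * (2 * k * l))" using kl l c by simp
      then have "(l * c)\<^sup>2 < l\<^sup>2 * (2 * l * k * c)" by (simp add: power2_eq_square ac_simps)
      then show ?thesis using s by (simp add: power_divide divide_strict_right_mono)
    qed
    then have "horofun f x < l" using horofun_less_iff[OF f xn l] by (simp add: xe xx)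
    moreover have "{x \<in> hyp_space. horofun a x < r} \<subseteq> interior (horoball a r)" for a :: "real^'n" and r
      by (intro interior_maximal open_strict_horoball) (auto simp: horoball_def)
    ultimately have "x \<in> interior (horoball e k) \<inter> interior (horoball f l)"
      using xn by auto
    then show False using disj by blast
  qed
qed

context equilateral_horosphere
begin

lemma horofun_on_facet_hyperplane:
  assumes "sum c UNIV = 1" and x: "x = e + (\<Sum>j\<in>UNIV. c j *\<^sub>R (v j - e))"
  shows "1 - x \<bullet> e = (\<Sum>j\<in>UNIV. c j * beta j)"
    and "1 - (norm x)\<^sup>2 = d\<^sup>2 / 2 * ((\<Sum>j\<in>UNIV. c j * beta j)\<^sup>2 - (\<Sum>j\<in>UNIV. (c j * beta j)\<^sup>2))"
proof -
  let ?s = "\<chi> j. c j * beta j"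
  have x': "x = 1 *\<^sub>R e + vertex_matrix *v ?s" by (simp add: x cone_point_eq)
  show "1 - x \<bullet> e = (\<Sum>j\<in>UNIV. c j * beta j)"
    by (simp add: x' inner_add_left ee comb_inner_e)
  have "(\<Sum>j\<in>UNIV. ?s $ j / beta j) = 1"
    using assms(1) beta_pos by (simp add: less_imp_neq[THEN not_sym])
  then show "1 - (norm x)\<^sup>2 = d\<^sup>2 / 2 * ((\<Sum>j\<in>UNIV. c j * beta j)\<^sup>2 - (\<Sum>j\<in>UNIV. (c j * beta j)\<^sup>2))"
    unfolding x' norm_translate comb_norm by (simp add: comb_inner_e)
qed

text \<open>
  In the coordinates \<open>s j = c j * beta j\<close> on the hyperplane, the horoball is given by an inequality
  between \<open>(\<Sum>j. s j)\<^sup>2\<close> and \<open>\<Sum>j. (s j)\<^sup>2\<close>. Up to the critical level it contradicts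
  Cauchy-Schwarz unless all \<open>s j\<close> are equal, which describes a single point. Above this level that
  point is in the interior of the horoball, together with its neighbours in the hyperplane.
\<close>

lemma meets_facet_at_most_once_iff:
  assumes n: "CARD('n) \<ge> 2" and k: "0 < k"
  shows "(\<exists>\<^sub>\<le>\<^sub>1x. x \<in> horoball e k \<inter> (affine hull (range v) \<inter> hyp_space)) \<longleftrightarrow>
     (k * d)\<^sup>2 * (real CARD('n) - 1) \<le> 2 * real CARD('n)"
proof
  let ?n = "real CARD('n)"
  define p where "p = (k * d)\<^sup>2 / 2"
  have p: "0 < p" using k d_pos by (simp add: p_def)
  {
    assume "(k * d)\<^sup>2 * (?n - 1) \<le> 2 * ?n"
    then have pn: "p * (?n - 1) \<le> ?n" by (simp add: p_def)
    define H where "H = (\<Sum>j\<in>UNIV. 1 / beta j)"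
    have form: "x = e + (\<Sum>j\<in>UNIV. (1 / (H * beta j)) *\<^sub>R (v j - e))"
      if x: "x \<in> horoball e k \<inter> (affine hull (range v) \<inter> hyp_space)" for x
    proof -
      obtain c where c: "sum c UNIV = 1" "x = e + (\<Sum>j\<in>UNIV. c j *\<^sub>R (v j - e))"
        using x mem_affine_hull_iff by blast
      define s where "s j = c j * beta j" for j
      define S where "S = (\<Sum>j\<in>UNIV. s j)"
      define Q where "Q = (\<Sum>j\<in>UNIV. (s j)\<^sup>2)"
      have xn: "norm x < 1" using x by simp
      have "(1 - x \<bullet> e)\<^sup>2 \<le> k\<^sup>2 * (1 - (norm x)\<^sup>2)"
        using x horofun_le_iff[OF norm_e xn k] by (simp add: horoball_def)
      then have 1: "S\<^sup>2 \<le> p * (S\<^sup>2 - Q)"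
        using horofun_on_facet_hyperplane[OF c] by (simp add: s_def S_def Q_def p_def power_mult_distrib)
      have "(?n - 1) * S\<^sup>2 \<le> (?n - 1) * (p * (S\<^sup>2 - Q))"
        using 1 n by (intro mult_left_mono) auto
      also have "\<dots> = p * (?n - 1) * (S\<^sup>2 - Q)" by simp
      also have "\<dots> \<le> ?n * (S\<^sup>2 - Q)"
      proof (intro mult_right_mono pn)
        have "0 \<le> p * (S\<^sup>2 - Q)" using 1 zero_le_power2[of S] by linarith
        then show "0 \<le> S\<^sup>2 - Q" using p by (simp add: zero_le_mult_iff)
      qed
      finally have "?n * (?n * Q - S\<^sup>2) \<le> 0" by (simp add: algebra_simps mult_nonneg_nonpos)
      then have "(\<Sum>j\<in>UNIV. (?n * s j - S)\<^sup>2) \<le> 0"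
        using sum_squares_deviation[of s] by (simp add: S_def Q_def)
      then have "(\<Sum>j\<in>UNIV. (?n * s j - S)\<^sup>2) = 0"
        using sum_nonneg[of UNIV "\<lambda>j. (?n * s j - S)\<^sup>2"] by simp
      then have "?n * s j = S" for j
        using sum_nonneg_eq_0_iff[of UNIV "\<lambda>j. (?n * s j - S)\<^sup>2"] by simp
      then have sj: "s j = S / ?n" for j by (simp add: field_simps)
      have cj: "c j = S / ?n * (1 / beta j)" for j
        using sj[of j] beta_pos[of j] by (simp add: s_def field_simps)
      have "S / ?n * H = 1"
        using c(1) unfolding cj H_def by (simp only: sum_distrib_left)
      then have "S / ?n = 1 / H" by (metis eq_divide_eq mult_zero_right zero_neq_one)
      then have "c = (\<lambda>j. 1 / (H * beta j))" by (simp add: cj fun_eq_iff)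
      then show ?thesis using c(2) by simp
    qed
    show "\<exists>\<^sub>\<le>\<^sub>1x. x \<in> horoball e k \<inter> (affine hull (range v) \<inter> hyp_space)"
    proof (rule Uniq_I)
      fix x y assume "x \<in> horoball e k \<inter> (affine hull (range v) \<inter> hyp_space)"
        and "y \<in> horoball e k \<inter> (affine hull (range v) \<inter> hyp_space)"
      from form[OF this(1)] form[OF this(2)] show "y = x" by simp
    qed
  }
  {
    assume U: "\<exists>\<^sub>\<le>\<^sub>1x. x \<in> horoball e k \<inter> (affine hull (range v) \<inter> hyp_space)"
    show "(k * d)\<^sup>2 * (?n - 1) \<le> 2 * ?n"
    proof (rule ccontr)
      assume "\<not> (k * d)\<^sup>2 * (?n - 1) \<le> 2 * ?n"
      then have pn: "?n < p * (?n - 1)" by (simp add: p_def)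
      define H where "H = (\<Sum>j\<in>UNIV. 1 / beta j)"
      have H: "0 < H" unfolding H_def using beta_pos by (intro sum_pos) auto
      define c where "c j = 1 / (H * beta j)" for j
      \<comment> \<open>The centre of the facet, with all \<open>s j\<close> equal.\<close>
      define x where "x = e + (\<Sum>j\<in>UNIV. c j *\<^sub>R (v j - e))"
      have c1: "sum c UNIV = 1"
      proof -
        have "sum c UNIV = (1 / H) * H" unfolding c_def by (subst (3) H_def) (simp add: sum_distrib_left)
        then show ?thesis using H by simp
      qed
      have cb: "c j * beta j = 1 / H" for j using beta_pos[of j] by (simp add: c_def)
      have xe: "1 - x \<bullet> e = ?n / H"
        using horofun_on_facet_hyperplane(1)[OF c1 x_def] by (simp add: cb)
      have xx: "1 - (norm x)\<^sup>2 = d\<^sup>2 / 2 * (?n * (?n - 1)) / H\<^sup>2"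
      proof -
        have "1 - (norm x)\<^sup>2 = d\<^sup>2 / 2 * ((?n * (1 / H))\<^sup>2 - ?n * (1 / H)\<^sup>2)"
          using horofun_on_facet_hyperplane(2)[OF c1 x_def] by (simp add: cb)
        also have "(?n * (1 / H))\<^sup>2 - ?n * (1 / H)\<^sup>2 = ?n * (?n - 1) * (1 / H)\<^sup>2"
          by (simp only: power_mult_distrib power2_eq_square) (simp add: algebra_simps)
        finally show ?thesis by (simp add: power_divide)
      qed
      have "0 < 1 - (norm x)\<^sup>2" unfolding xx using n H d_pos by simp
      then have xn: "norm x < 1" by (rule gap_pos_norm_less_one)
      have "(?n / H)\<^sup>2 < k\<^sup>2 * (d\<^sup>2 / 2 * (?n * (?n - 1)) / H\<^sup>2)"
      proof -
        have "?n * ?n < ?n * (p * (?n - 1))" using pn by (intro mult_strict_left_mono) auto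
        also have "\<dots> = k\<^sup>2 * (d\<^sup>2 / 2 * (?n * (?n - 1)))" by (simp add: p_def power_mult_distrib)
        finally have "?n * ?n / H\<^sup>2 < k\<^sup>2 * (d\<^sup>2 / 2 * (?n * (?n - 1))) / H\<^sup>2"
          using H by (intro divide_strict_right_mono) auto
        then show ?thesis by (simp add: power_divide power2_eq_square[of ?n])
      qed
      then have xk: "horofun e x < k" using horofun_less_iff[OF norm_e xn k] by (simp add: xe xx)
      obtain r where r: "0 < r" "ball x r \<subseteq> {x \<in> hyp_space. horofun e x < k}"
        using open_strict_horoball[of e k] xn xk by (auto simp: open_contains_ball)
      obtain j :: 'n where True by simp
      define t where "t = r / (2 * (norm (v j - x) + 1))"
      have t: "0 < t" unfolding t_def using r by (intro small_step) auto
      define y where "y = x + t *\<^sub>R (v j - x)"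
      have "t * norm (v j - x) < r" unfolding t_def using r by (intro small_step) auto
      then have "y \<in> ball x r" using t by (simp add: dist_norm y_def)
      then have yk: "norm y < 1" "horofun e y < k" using r by auto
      have xa: "x \<in> affine hull (range v)" using c1 x_def mem_affine_hull_iff by blast
      have "y = (1 - t) *\<^sub>R x + t *\<^sub>R v j" by (simp add: y_def algebra_simps)
      also have "\<dots> \<in> affine hull (range v)"
        using xa by (intro mem_affine affine_affine_hull) (auto intro: hull_inc)
      finally have ya: "y \<in> affine hull (range v)" .
      have "x = y"
        using U xa ya xn xk yk unfolding Uniq_def by (auto simp: horoball_def)
      then have "v j = x" using t by (simp add: y_def)
      then show False using norm_v[of j] xn by simp
    qed
  }
qed

end

text \<open>
  The normalisation of the null vectors makes the other vertices equidistant as seen from \<open>E i\<close>,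
  with the distance \<open>w i\<close>.
\<close>

lemma vertex_frame:
  fixes E :: "nat \<Rightarrow> real^'n" and w :: "nat \<Rightarrow> real"
  assumes E: "ideal_simplex E" and w: "\<And>i. 0 < w i"
    and eq: "\<And>i j. i \<le> CARD('n) \<Longrightarrow> j \<le> CARD('n) \<Longrightarrow> i \<noteq> j \<Longrightarrow> w i * w j * (1 - E i \<bullet> E j) = 2"
    and i: "i \<le> CARD('n)"
  obtains v :: "'n \<Rightarrow> real^'n" where "equilateral_horosphere (E i) v (w i)"
    and "range v = E ` ({..CARD('n)} - {i})"
proof -
  let ?n = "CARD('n)"
  have "card ({..?n} - {i}) = card (UNIV :: 'n set)" using i by simp
  then obtain h :: "'n \<Rightarrow> nat" where h: "bij_betw h UNIV ({..?n} - {i})"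
    using finite_same_card_bij[of "UNIV :: 'n set" "{..?n} - {i}"] by auto
  have hi: "h j \<le> ?n" "h j \<noteq> i" for j
    using bij_betwE[OF h] by auto
  have h_inj: "h j \<noteq> h k" if "j \<noteq> k" for j k
    using h that by (auto simp: bij_betw_def inj_on_def)
  have nE: "norm (E j) = 1" if "j \<le> ?n" for j using E that by (auto simp: ideal_simplex_def)
  have gap: "1 - E j \<bullet> E k = 2 / (w j * w k)" if "j \<le> ?n" "k \<le> ?n" "j \<noteq> k" for j k
  proof -
    have "w j * w k \<noteq> 0" using w[of j] w[of k] by simp
    then show ?thesis using eq[OF that] by (simp add: eq_divide_eq mult.commute)
  qed
  have "equilateral_horosphere (E i) (E \<circ> h) (w i)"
  proof
    show "norm (E i) = 1" using nE i .
    show "norm ((E \<circ> h) j) = 1" for j using nE hi by simp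
    show "(E \<circ> h) j \<noteq> E i" for j
      using E hi[of j] i by (auto simp: ideal_simplex_def inj_on_def)
    show "0 < w i" by (rule w)
    show "1 - (E \<circ> h) j \<bullet> (E \<circ> h) k = (w i)\<^sup>2 / 2 * (1 - (E \<circ> h) j \<bullet> E i) * (1 - (E \<circ> h) k \<bullet> E i)"
      if "j \<noteq> k" for j k
      using gap[OF hi(1) hi(1) h_inj[OF that]] gap[OF hi(1)[of j] i hi(2)] gap[OF hi(1)[of k] i hi(2)]
        w[of i] by (simp add: power2_eq_square)
  qed
  moreover have "range (E \<circ> h) = E ` ({..?n} - {i})"
    using bij_betw_imp_surj_on[OF h] by (metis image_comp)
  ultimately show ?thesis by (rule that)
qed

theorem theorem3p7:
  fixes E :: "nat \<Rightarrow> real^'n" and n :: nat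
  assumes "CARD('n) = n" and "n \<ge> 3"
    and "ideal_simplex E" and "regular_simplex E"
  shows "\<exists>B_opt. admissible E B_opt \<and>
    (\<forall>B. admissible E B \<longrightarrow> horoball_density E B \<le> horoball_density E B_opt) \<and>
    horoball_density E B_opt =
      1 / (real n - 1) * (real n / 2 ^ (n - 1)) *
      (\<Prod>k=2..n-1. ((real k - 1) / (real k + 1)) powr ((real n - real k) / 2)) *
      (sqrt (2 * real n / (real n - 1)) ^ (n - 1) +
       real n * sqrt (2 * real n / (real n - 1)) powi (- int (n - 1))) *
      (1 / hyp_vol (simplex_of E))"
proof -
  have n: "n = CARD('n)" and n3: "3 \<le> n" using assms by simp_all
  have n2: "CARD('n) \<ge> 2" using n n3 by simp
  note E = assms(3)
  obtain w :: "nat \<Rightarrow> real" where w: "\<And>i. 0 < w i"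
    and ww: "\<And>i j. i \<le> n \<Longrightarrow> j \<le> n \<Longrightarrow> i \<noteq> j \<Longrightarrow> w i * w j * (1 - E i \<bullet> E j) = 2"
    using regular_ideal_simplex_weights[OF E assms(4) n2] unfolding n by metis
  have nE: "norm (E i) = 1" if "i \<le> n" for i using E that by (auto simp: ideal_simplex_def n)
  have neE: "E i \<noteq> E j" if "i \<le> n" "j \<le> n" "i \<noteq> j" for i j
    using E that by (auto simp: ideal_simplex_def inj_on_def n)
  define L where "L = sqrt (2 * real n / (real n - 1))"
  define K where "K = sqrt (real n) / ((real n - 1) * fact (n - 1) * sqrt 2 ^ (n - 1))"
  have K: "0 \<le> K" using n3 by (simp add: K_def)
  have L2: "L\<^sup>2 = 2 * real n / (real n - 1)" using n3 by (simp add: L_def)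
  have L1: "1 < L"
  proof -
    have "1 < 2 * real n / (real n - 1)" using n3 by (simp add: field_simps)
    then show ?thesis by (simp add: L_def)
  qed
  have scale_iff: "(r * w i)\<^sup>2 * (real n - 1) \<le> 2 * real n \<longleftrightarrow> r * w i \<le> L" if "0 < r" for r i
  proof -
    have "(r * w i)\<^sup>2 * (real n - 1) \<le> 2 * real n \<longleftrightarrow> (r * w i)\<^sup>2 \<le> L\<^sup>2"
      unfolding L2 using n3 by (simp add: pos_le_divide_eq)
    also have "\<dots> \<longleftrightarrow> r * w i \<le> L"
      using that w[of i] L1 by (intro power2_le_iff_abs_le[THEN trans]) auto
    finally show ?thesis .
  qed
  have touch: "(\<exists>\<^sub>\<le>\<^sub>1x. x \<in> horoball (E i) r \<inter> opposite_hyperplane E i) \<longleftrightarrow> r * w i \<le> L"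
    if i: "i \<le> n" and r: "0 < r" for i r
  proof -
    obtain v :: "'n \<Rightarrow> real^'n" where v: "equilateral_horosphere (E i) v (w i)"
        "range v = E ` ({..CARD('n)} - {i})"
      by (rule vertex_frame[OF E w ww[unfolded n] i[unfolded n]])
    show ?thesis
      using equilateral_horosphere.meets_facet_at_most_once_iff[OF v(1) n2 r] scale_iff[OF r, of i]
      unfolding opposite_hyperplane_def v(2) n by simp
  qed
  have volume: "hyp_vol (horoball (E i) r \<inter> simplex_of E) = K * (r * w i) ^ (n - 1)"
    if i: "i \<le> n" and r: "0 < r" and le: "r * w i \<le> L" for i r
  proof -
    obtain v :: "'n \<Rightarrow> real^'n" where v: "equilateral_horosphere (E i) v (w i)"
        "range v = E ` ({..CARD('n)} - {i})"
      by (rule vertex_frame[OF E w ww[unfolded n] i[unfolded n]])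
    have "simplex_of E = convex hull (insert (E i) (range v))"
      unfolding simplex_of_def v(2) using i n by (intro arg_cong[of _ _ "(hull) convex"]) auto
    then show ?thesis
      using equilateral_horosphere.hyp_vol_horoball_simplex[OF v(1) n2 r] scale_iff[OF r, of i] le
      by (simp add: n K_def)
  qed
  have pack: "interior (horoball (E i) r) \<inter> interior (horoball (E j) q) = {} \<longleftrightarrow> (r * w i) * (q * w j) \<le> 1"
    if ij: "i \<le> n" "j \<le> n" "i \<noteq> j" and r: "0 < r" and q: "0 < q" for i j r q
  proof -
    have p: "0 < w i * w j" using w by simp
    have "interior (horoball (E i) r) \<inter> interior (horoball (E j) q) = {} \<longleftrightarrow> 2 * r * q \<le> 1 - E i \<bullet> E j"
      using ij r q by (intro disjoint_horoballs_iff nE neE)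
    also have "\<dots> \<longleftrightarrow> (w i * w j) * (2 * r * q) \<le> (w i * w j) * (1 - E i \<bullet> E j)"
      using p by (simp only: mult_le_cancel_left_pos)
    also have "\<dots> \<longleftrightarrow> (r * w i) * (q * w j) \<le> 1"
      unfolding ww[OF ij] by (simp add: ac_simps)
    finally show ?thesis .
  qed
  have density: "horoball_density E B = K * (\<Sum>i\<le>n. (r i * w i) ^ (n - 1)) / hyp_vol (simplex_of E)"
    if "\<And>i. i \<le> n \<Longrightarrow> B i = horoball (E i) (r i) \<and> 0 < r i \<and> r i * w i \<le> L" for B r
    unfolding horoball_density_def n[symmetric] sum_distrib_left
    using that volume by (intro arg_cong2[of _ _ _ _ "(/)"] sum.cong) auto
  \<comment> \<open>The optimal arrangement: the horoball at one vertex touches the opposite facet, the others touch it.\<close>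
  define r where "r i = (if i = 0 then L else 1 / L) / w i" for i
  define B where "B i = horoball (E i) (r i)" for i
  have rw: "r i * w i = (if i = 0 then L else 1 / L)" for i
    using w[of i] by (simp add: r_def)
  have r0: "0 < r i" for i using w[of i] L1 by (simp add: r_def)
  have invL: "1 / L < 1" using L1 by simp
  have invL_le: "1 / L \<le> L" using L1 invL by linarith
  then have rL: "r i * w i \<le> L" for i unfolding rw by simp
  have adm: "admissible E B"
    unfolding admissible_def n[symmetric]
  proof (intro conjI allI impI)
    fix i assume i: "i \<le> n"
    show "horoball_at (E i) (B i)" using horoball_at_iff[OF nE[OF i]] r0 by (auto simp: B_def)
    show "\<exists>\<^sub>\<le>\<^sub>1x. x \<in> B i \<inter> opposite_hyperplane E i"
      unfolding B_def using touch[OF i r0] rL by simp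
    fix j assume j: "j \<le> n" and ij: "i \<noteq> j"
    have "1 / L * (1 / L) \<le> 1 * 1" using invL L1 by (intro mult_mono) auto
    then have "(r i * w i) * (r j * w j) \<le> 1"
      unfolding rw using ij L1 invL_le by auto
    then show "interior (B i) \<inter> interior (B j) = {}"
      unfolding B_def using pack[OF i j ij r0 r0] by simp
  qed
  have sum_opt: "(\<Sum>i\<le>n. (r i * w i) ^ (n - 1)) = L ^ (n - 1) + real n / L ^ (n - 1)"
  proof -
    have "(\<Sum>i\<le>n. (r i * w i) ^ (n - 1)) = L ^ (n - 1) + (\<Sum>i\<in>{..n} - {0}. (r i * w i) ^ (n - 1))"
      by (subst sum.remove[of _ 0]) (simp_all add: rw)
    also have "(\<Sum>i\<in>{..n} - {0}. (r i * w i) ^ (n - 1)) = (\<Sum>i\<in>{..n} - {0}. 1 / L ^ (n - 1))"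
      by (intro sum.cong) (auto simp: rw power_divide)
    finally show ?thesis by simp
  qed
  have dens_opt: "horoball_density E B = K * (L ^ (n - 1) + real n / L ^ (n - 1)) / hyp_vol (simplex_of E)"
  proof -
    have "horoball_density E B = K * (\<Sum>i\<le>n. (r i * w i) ^ (n - 1)) / hyp_vol (simplex_of E)"
      using rL r0 by (intro density) (simp add: B_def)
    then show ?thesis unfolding sum_opt .
  qed
  have "horoball_density E C \<le> horoball_density E B" if C: "admissible E C" for C
  proof -
    have "\<forall>i\<le>n. \<exists>k>0. C i = horoball (E i) k"
      using C horoball_at_iff[OF nE] unfolding admissible_def n[symmetric] by blast
    then obtain k where k: "\<And>i. i \<le> n \<Longrightarrow> 0 < k i" "\<And>i. i \<le> n \<Longrightarrow> C i = horoball (E i) (k i)"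
      by metis
    have kL: "k i * w i \<le> L" if i: "i \<le> n" for i
      using C touch[OF i k(1)[OF i]] k(2)[OF i] i unfolding admissible_def n[symmetric] by auto
    have kk: "(k i * w i) * (k j * w j) \<le> 1" if ij: "i \<le> n" "j \<le> n" "i \<noteq> j" for i j
    proof -
      have "interior (C i) \<inter> interior (C j) = {}"
        using C ij unfolding admissible_def n[symmetric] by blast
      then show ?thesis
        using pack[OF ij k(1)[OF ij(1)] k(1)[OF ij(2)]] by (simp add: k(2) ij)
    qed
    have kpos: "0 < k i * w i" if "i \<le> n" for i using k(1)[OF that] w[of i] by simp
    have "(\<Sum>i\<le>n. (k i * w i) ^ (n - 1)) \<le> L ^ (n - 1) + real n / L ^ (n - 1)"
    proof (rule sum_le_of_pairwise_product_le_one)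
      show "real n \<le> L ^ (n - 1)" unfolding L_def using n3 by (rule critical_scale_ge)
      show "1 \<le> L ^ (n - 1)" using L1 by simp
      show "0 < (k i * w i) ^ (n - 1)" if "i \<le> n" for i using kpos[OF that] by simp
      show "(k i * w i) ^ (n - 1) \<le> L ^ (n - 1)" if "i \<le> n" for i
        using kL[OF that] kpos[OF that] by (intro power_mono) auto
      show "(k i * w i) ^ (n - 1) * (k j * w j) ^ (n - 1) \<le> 1" if "i \<le> n" "j \<le> n" "i \<noteq> j" for i j
        unfolding power_mult_distrib[symmetric]
        using kk[OF that] kpos[OF that(1)] kpos[OF that(2)] by (intro power_le_one) auto
    qed
    then have "K * (\<Sum>i\<le>n. (k i * w i) ^ (n - 1)) / hyp_vol (simplex_of E) \<le>
        K * (L ^ (n - 1) + real n / L ^ (n - 1)) / hyp_vol (simplex_of E)"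
      using K by (intro divide_right_mono mult_left_mono) (auto simp: hyp_vol_def)
    then show ?thesis using density[of C k] k kL by (simp add: dens_opt)
  qed
  moreover have "horoball_density E B =
      1 / (real n - 1) * (real n / 2 ^ (n - 1)) *
      (\<Prod>k=2..n-1. ((real k - 1) / (real k + 1)) powr ((real n - real k) / 2)) *
      (L ^ (n - 1) + real n * L powi (- int (n - 1))) * (1 / hyp_vol (simplex_of E))"
  proof -
    have "L powi (- int (n - 1)) = 1 / L ^ (n - 1)"
      by (simp add: power_int_minus inverse_eq_divide)
    moreover have "1 / (real n - 1) * (real n / 2 ^ (n - 1)) * (sqrt 2 ^ (n - 1) / (sqrt (real n) * fact (n - 1))) = K"
    proof -
      have "(2::real) ^ (n - 1) = sqrt 2 ^ (n - 1) * sqrt 2 ^ (n - 1)"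
        by (simp flip: power_mult_distrib)
      moreover have "real n = sqrt (real n) * sqrt (real n)" by simp
      ultimately have "real n / 2 ^ (n - 1) * (sqrt 2 ^ (n - 1) / (sqrt (real n) * fact (n - 1))) =
          (sqrt (real n) * sqrt (real n)) / (sqrt 2 ^ (n - 1) * sqrt 2 ^ (n - 1)) *
          (sqrt 2 ^ (n - 1) / (sqrt (real n) * fact (n - 1)))" by metis
      also have "\<dots> = sqrt (real n) / (fact (n - 1) * sqrt 2 ^ (n - 1))"
      proof -
        have cancel: "a * a / (b * b) * (b / (a * c)) = a / (c * b)" if "a \<noteq> 0" "b \<noteq> 0" "c \<noteq> 0" for a b c :: real
          using that by (simp add: field_simps)
        show ?thesis using n3 by (intro cancel) simp_all
      qed
      finally have "real n / 2 ^ (n - 1) * (sqrt 2 ^ (n - 1) / (sqrt (real n) * fact (n - 1))) =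
          sqrt (real n) / (fact (n - 1) * sqrt 2 ^ (n - 1))" .
      then show ?thesis unfolding mult.assoc by (simp only: K_def) simp
    qed
    ultimately show ?thesis
      using n3 by (simp only: simplex_product_formula dens_opt) simp
  qed
  ultimately show ?thesis using adm unfolding L_def by blast
qed

end
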